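(* Let $a,b$ be nonnegative integers with $a\ge b$ and let $n\ge a+b$. Let $\Phi\in\operatorname{Hom}_G(\Lambda^a\otimes\Lambda^b,\Lambda^a\otimes\Lambda^b)$ and write $\Phi=\sum_{t=0}^{b}a_t\Phi_t$ with $a_t\in K$. Let $0\le i\le b$. Then the cokernel of $\Phi$ is isomorphic to $L_{(a+i,b-i)}$ if and only if (1) $\sum_{t=0}^{i}a_t\,c_t(a,b,i)=0$, and (2) $\sum_{t=0}^{j}a_t\,c_t(a,b,j)\neq 0$ for all $j\in\{0,\dots,b\}\setminus\{i\}$, where $c_t(a,b,j)=\binom{j}{t}\binom{a-b+t+j}{t}$.
   Context: $K$ is a field of characteristic zero, $G=GL(n,K)$, $V=K^n$ the natural module of column vectors, $\Lambda=\bigoplus_i\Lambda^i$ the exterior algebra of $V$ (with $\Lambda^i=0$ for $i<0$). $m:\Lambda^s\otimes\Lambda^t\to\Lambda^{s+t}$ is multiplication and $\Delta_{s,t}:\Lambda^{s+t}\to\Lambda^s\otimes\Lambda^t$ is the comultiplication $v_1\cdots v_{s+t}\mapsto\sum_\sigma \mathrm{sgn}(\sigma)v_{\sigma(1)}\cdots v_{\sigma(s)}\otimes v_{\sigma(s+1)}\cdots v_{\sigma(s+t)}$, summed over permutations with $\sigma(1)<\dots<\sigma(s)$ and $\sigma(s+1)<\dots<\sigma(s+t)$. For $0\le t\le b$: $\delta_t=(m\otimes1)\circ(1\otimes\Delta_{t,b-t}):\Lambda^a\otimes\Lambda^b\to\Lambda^{a+t}\otimes\Lambda^{b-t}$; $\theta_t=(1\otimes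 m)\circ(\Delta_{a-t,t}\otimes1):\Lambda^a\otimes\Lambda^b\to\Lambda^{a-t}\otimes\Lambda^{b+t}$ (with $a,b$ replaced by the relevant degrees); $\Phi_t=\theta_t\circ\delta_t:\Lambda^a\otimes\Lambda^b\to\Lambda^a\otimes\Lambda^b$. For a partition $\mu=(\mu_1,\dots,\mu_\ell)$, $\Lambda^\mu=\Lambda^{\mu_1}\otimes\cdots\otimes\Lambda^{\mu_\ell}$ and $L_\mu$ is the Schur module, i.e. the irreducible polynomial $G$-module with highest weight the conjugate $\mu'$; equivalently, $L_\mu$ is the cokernel of $\theta_\mu=\sum_{c=1}^{\ell-1}1\otimes\cdots\otimes\theta_1\otimes\cdots\otimes1:\bigoplus_{c=1}^{\ell-1}\Lambda^{\mu_1}\otimes\cdots\otimes\Lambda^{\mu_c+1}\otimes\Lambda^{\mu_{c+1}-1}\otimes\cdots\otimes\Lambda^{\mu_\ell}\to\Lambda^\mu$ (with $\theta_1$ acting on tensor factors $c,c+1$). The maps $\Phi_0,\dots,\Phi_b$ form a basis of $\operatorname{Hom}_G(\Lambda^a\otimes\Lambda^b,\Lambda^a\otimes\Lambda^b)$ when $n\ge a+b$. *)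

theory Defs
  imports Main "Jordan_Normal_Form.Determinant" "Jordan_Normal_Form.DL_Submatrix"
begin

text \<open>Concrete model. V = K^n with standard basis e_0,...,e_(n-1).
  Lambda^p has basis e_S (S a p-subset of {0..<n}, e_S = wedge of e_s in increasing order).
  An element of Lambda^p (x) Lambda^q is a function on pairs (S,T) supported on the basis.\<close>

definition ext_basis :: "nat \<Rightarrow> nat \<Rightarrow> nat set set" where
  "ext_basis n p = {S. S \<subseteq> {..<n} \<and> card S = p}"

definition tens_basis :: "nat \<Rightarrow> nat \<Rightarrow> nat \<Rightarrow> (nat set \<times> nat set) set" where
  "tens_basis n p q = ext_basis n p \<times> ext_basis n q"

definition tens_space :: "nat \<Rightarrow> nat \<Rightarrow> nat \<Rightarrow> (nat set \<times> nat set \<Rightarrow> 'k::field) set" where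
  "tens_space n p q = {v. \<forall>x. v x \<noteq> 0 \<longrightarrow> x \<in> tens_basis n p q}"

text \<open>Sign with e_S \<and> e_T = wsign S T * e_(S \<union> T) for disjoint S, T;
  it is also the sign of the shuffle permutation in the comultiplication.\<close>
definition wsign :: "nat set \<Rightarrow> nat set \<Rightarrow> 'k::field" where
  "wsign S T = (-1) ^ card {(s,t). s \<in> S \<and> t \<in> T \<and> t < s}"

definition lin_ext :: "nat \<Rightarrow> nat \<Rightarrow> nat \<Rightarrow> (nat set \<times> nat set \<Rightarrow> nat set \<times> nat set \<Rightarrow> 'k::field)
     \<Rightarrow> (nat set \<times> nat set \<Rightarrow> 'k) \<Rightarrow> (nat set \<times> nat set \<Rightarrow> 'k)" where
  "lin_ext n p q img v = (\<lambda>y. \<Sum>x\<in>tens_basis n p q. v x * img x y)"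

text \<open>delta_t = (m \<otimes> 1) o (1 \<otimes> Delta_(t,b-t)) on basis elements e_S \<otimes> e_T:
  sum over t-subsets R of T of wsign R (T-R) * (e_S \<and> e_R) \<otimes> e_(T-R).\<close>
definition delta_basis :: "nat \<Rightarrow> nat set \<times> nat set \<Rightarrow> nat set \<times> nat set \<Rightarrow> 'k::field" where
  "delta_basis t x y = (case x of (S,T) \<Rightarrow> case y of (S',T') \<Rightarrow>
     \<Sum>R\<in>{R. R \<subseteq> T \<and> card R = t}.
       if S \<inter> R = {} \<and> S' = S \<union> R \<and> T' = T - R then wsign R (T - R) * wsign S R else 0)"

text \<open>theta_t = (1 \<otimes> m) o (Delta_(a-t,t) \<otimes> 1) on basis elements e_S \<otimes> e_T:
  sum over t-subsets R of S of wsign (S-R) R * e_(S-R) \<otimes> (e_R \<and> e_T).\<close>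
definition theta_basis :: "nat \<Rightarrow> nat set \<times> nat set \<Rightarrow> nat set \<times> nat set \<Rightarrow> 'k::field" where
  "theta_basis t x y = (case x of (S,T) \<Rightarrow> case y of (S',T') \<Rightarrow>
     \<Sum>R\<in>{R. R \<subseteq> S \<and> card R = t}.
       if R \<inter> T = {} \<and> S' = S - R \<and> T' = R \<union> T then wsign (S - R) R * wsign R T else 0)"

definition delta_map :: "nat \<Rightarrow> nat \<Rightarrow> nat \<Rightarrow> nat \<Rightarrow> (nat set \<times> nat set \<Rightarrow> 'k::field) \<Rightarrow> (nat set \<times> nat set \<Rightarrow> 'k)" where
  "delta_map n a b t = lin_ext n a b (delta_basis t)"

definition theta_map :: "nat \<Rightarrow> nat \<Rightarrow> nat \<Rightarrow> nat \<Rightarrow> (nat set \<times> nat set \<Rightarrow> 'k::field) \<Rightarrow> (nat set \<times> nat set \<Rightarrow> 'k)" where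
  "theta_map n a b t = lin_ext n a b (theta_basis t)"

definition Phi_map :: "nat \<Rightarrow> nat \<Rightarrow> nat \<Rightarrow> nat \<Rightarrow> (nat set \<times> nat set \<Rightarrow> 'k::field) \<Rightarrow> (nat set \<times> nat set \<Rightarrow> 'k)" where
  "Phi_map n a b t v = theta_map n (a + t) (b - t) t (delta_map n a b t v)"

definition Phi_comb :: "nat \<Rightarrow> nat \<Rightarrow> nat \<Rightarrow> (nat \<Rightarrow> 'k::field) \<Rightarrow> (nat set \<times> nat set \<Rightarrow> 'k) \<Rightarrow> (nat set \<times> nat set \<Rightarrow> 'k)" where
  "Phi_comb n a b c v = (\<lambda>y. \<Sum>t\<in>{0..b}. c t * Phi_map n a b t v y)"

text \<open>The group G = GL(n,K) and its action on Lambda^p \<otimes> Lambda^q: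
  g e_S = sum over S' of det(g[S',S]) e_S'.\<close>
definition GL :: "nat \<Rightarrow> 'k::field mat set" where
  "GL n = {g. g \<in> carrier_mat n n \<and> invertible_mat g}"

definition tens_act :: "nat \<Rightarrow> nat \<Rightarrow> nat \<Rightarrow> 'k::field mat \<Rightarrow> (nat set \<times> nat set \<Rightarrow> 'k) \<Rightarrow> (nat set \<times> nat set \<Rightarrow> 'k)" where
  "tens_act n p q g v = (\<lambda>(S',T'). if (S',T') \<in> tens_basis n p q then
      (\<Sum>(S,T)\<in>tens_basis n p q. det (submatrix g S' S) * det (submatrix g T' T) * v (S,T)) else 0)"

definition coset :: "('a \<Rightarrow> 'k::field) set \<Rightarrow> ('a \<Rightarrow> 'k) \<Rightarrow> ('a \<Rightarrow> 'k) set" where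
  "coset W v = (\<lambda>w. (\<lambda>x. v x + w x)) ` W"

definition quot :: "('a \<Rightarrow> 'k::field) set \<Rightarrow> ('a \<Rightarrow> 'k) set \<Rightarrow> ('a \<Rightarrow> 'k) set set" where
  "quot V W = coset W ` V"

definition quot_iso :: "'g set \<Rightarrow> ('g \<Rightarrow> ('a \<Rightarrow> 'k) \<Rightarrow> ('a \<Rightarrow> 'k)) \<Rightarrow> ('a \<Rightarrow> 'k::field) set \<Rightarrow> ('a \<Rightarrow> 'k) set
     \<Rightarrow> ('g \<Rightarrow> ('b \<Rightarrow> 'k) \<Rightarrow> ('b \<Rightarrow> 'k)) \<Rightarrow> ('b \<Rightarrow> 'k) set \<Rightarrow> ('b \<Rightarrow> 'k) set \<Rightarrow> bool" where
  "quot_iso G act V W act' V' W' \<longleftrightarrow>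
     (\<exists>F. bij_betw F (quot V W) (quot V' W') \<and>
       (\<forall>u\<in>V. \<forall>v\<in>V. \<forall>c. \<forall>u'\<in>V'. \<forall>v'\<in>V'.
          F (coset W u) = coset W' u' \<longrightarrow> F (coset W v) = coset W' v' \<longrightarrow>
          F (coset W (\<lambda>x. c * u x + v x)) = coset W' (\<lambda>x. c * u' x + v' x)) \<and>
       (\<forall>g\<in>G. \<forall>v\<in>V. \<forall>v'\<in>V'.
          F (coset W v) = coset W' v' \<longrightarrow> F (coset W (act g v)) = coset W' (act' g v')))"

definition Phi_image :: "nat \<Rightarrow> nat \<Rightarrow> nat \<Rightarrow> (nat \<Rightarrow> 'k::field) \<Rightarrow> (nat set \<times> nat set \<Rightarrow> 'k) set" where
  "Phi_image n a b c = Phi_comb n a b c ` tens_space n a b"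

text \<open>Schur module L_(p,q) = coker(theta_1 : Lambda^(p+1) \<otimes> Lambda^(q-1) \<rightarrow> Lambda^p \<otimes> Lambda^q),
  where Lambda^(q-1) = 0 if q = 0.\<close>
definition schur_rel :: "nat \<Rightarrow> nat \<Rightarrow> nat \<Rightarrow> (nat set \<times> nat set \<Rightarrow> 'k::field) set" where
  "schur_rel n p q = (if q = 0 then {\<lambda>_. 0} else theta_map n (p + 1) (q - 1) 1 ` tens_space n (p + 1) (q - 1))"

definition ccoef :: "nat \<Rightarrow> nat \<Rightarrow> nat \<Rightarrow> nat \<Rightarrow> 'k::field" where
  "ccoef a b j t = of_nat (j choose t) * of_nat ((a - b + t + j) choose t)"

end

theory Submission
  imports Defs "HOL-Library.Function_Algebras"
begin

text \<open>
  On the exterior algebra of \<open>V \<otimes> K\<^sup>2\<close>, that is on \<open>\<Lambda> \<otimes> \<Lambda>\<close>, the maps \<open>\<delta>\<^sub>1\<close> and \<open>\<theta>\<^sub>1\<close> are the raising and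
  lowering operators \<open>E\<close>, \<open>F\<close> of an \<open>sl\<^sub>2\<close>-action commuting with \<open>GL(V)\<close>, and \<open>\<delta>\<^sub>t = E\<^sup>t / t!\<close>,
  \<open>\<theta>\<^sub>t = F\<^sup>t / t!\<close>. With \<open>H\<^sub>j = ker E\<close> on \<open>\<Lambda>\<^bsup>a+j\<^esup> \<otimes> \<Lambda>\<^bsup>b-j\<^esup>\<close>, the space \<open>\<Lambda>\<^sup>a \<otimes> \<Lambda>\<^sup>b\<close> is the direct
  sum of the \<open>F\<^sup>j H\<^sub>j\<close> for \<open>j \<le> b\<close>, and \<open>\<Phi>\<close> acts on the \<open>j\<close>-th summand by the scalar \<open>\<Sum>\<^sub>t a\<^sub>t c\<^sub>t(a,b,j)\<close>.
  Moreover \<open>L\<^bsub>(a+j,b-j)\<^esub> \<cong> H\<^sub>j\<close>, since \<open>\<Lambda>\<^bsup>a+j\<^esup> \<otimes> \<Lambda>\<^bsup>b-j\<^esup> = H\<^sub>j \<oplus> im F\<close>. Hence the cokernel of \<open>\<Phi>\<close> is the sum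
  of the \<open>L\<^bsub>(a+j,b-j)\<^esub>\<close> over the \<open>j\<close> whose scalar vanishes. That this sum is isomorphic to \<open>L\<^bsub>(a+i,b-i)\<^esub>\<close>
  only if \<open>i\<close> is the unique such \<open>j\<close> is seen without irreducibility: weight vectors of one diagonal matrix
  with dominance-separated weights show that the smallest such \<open>j\<close> is \<open>i\<close>, and finite-dimensionality
  excludes further summands.
\<close>

section \<open>Weight spaces of an \<open>sl\<^sub>2\<close>-action\<close>

text \<open>\<open>X q\<close> stands for the weight space of weight \<open>N - 2 * q\<close>, so
  \<open>E\<close> raises the weight and lowers \<open>q\<close>. \<open>E_X0\<close> expresses that
  the space before \<open>X 0\<close> is zero. The commutator is prescribed on each
  \<open>X q\<close> separately because it is a scalar only there. In the application
  \<open>N\<close> is the total degree and \<open>q\<close> the degree of the second tensor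
  factor.\<close>

locale sl2_weights = vector_space scale
  for scale :: "'k::field_char_0 \<Rightarrow> 'v::ab_group_add \<Rightarrow> 'v" (infixr "*s" 75) +
  fixes E F :: "'v \<Rightarrow> 'v" and X :: "nat \<Rightarrow> 'v set" and N :: nat
  assumes linear_E: "Vector_Spaces.linear scale scale E"
    and linear_F: "Vector_Spaces.linear scale scale F"
    and subspace_X: "subspace (X q)"
    and E_X0: "v \<in> X 0 \<Longrightarrow> E v = 0"
    and E_X: "v \<in> X (Suc q) \<Longrightarrow> E v \<in> X q"
    and F_X: "v \<in> X q \<Longrightarrow> F v \<in> X (Suc q)"
    and EF_comm: "v \<in> X q \<Longrightarrow> E (F v) = F (E v) + (of_nat N - 2 * of_nat q) *s v"
begin

lemma linear_funpow: "Vector_Spaces.linear scale scale f \<Longrightarrow> Vector_Spaces.linear scale scale (f ^^ k)"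
  by (induction k) (auto simp: Vector_Spaces.linear_iff vector_space_axioms)

sublocale E: Vector_Spaces.linear scale scale E by (rule linear_E)
sublocale F: Vector_Spaces.linear scale scale F by (rule linear_F)
sublocale Epow: Vector_Spaces.linear scale scale "E ^^ k" for k by (rule linear_funpow[OF linear_E])
sublocale Fpow: Vector_Spaces.linear scale scale "F ^^ k" for k by (rule linear_funpow[OF linear_F])

lemma Fpow_X: "v \<in> X q \<Longrightarrow> (F ^^ k) v \<in> X (q + k)"
  by (induction k) (auto intro: F_X)

lemma Epow_X: "v \<in> X (q + k) \<Longrightarrow> (E ^^ k) v \<in> X q"
proof (induction k arbitrary: v)
  case (Suc k)
  then have "E v \<in> X (q + k)" by (intro E_X) simp
  from Suc.IH[OF this] show ?case by (simp add: funpow_swap1)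
qed simp

lemma Epow_X0: "v \<in> X q \<Longrightarrow> q < k \<Longrightarrow> (E ^^ k) v = 0"
proof -
  assume v: "v \<in> X q" and "q < k"
  then obtain m where k: "k = m + Suc q" by (metis add_Suc_right add.commute less_imp_Suc_add)
  have "(E ^^ q) v \<in> X 0" using v by (intro Epow_X) simp
  then have "(E ^^ Suc q) v = 0" by (simp add: E_X0)
  then show ?thesis unfolding k funpow_add comp_def by (simp add: Epow.zero)
qed

section \<open>Highest weight vectors and the decomposition of weight spaces\<close>

definition H :: "nat \<Rightarrow> 'v set" where "H q = {u \<in> X q. E u = 0}"

lemma subspace_H: "subspace (H q)"
  using subspace_X[of q] by (auto simp: H_def subspace_def E.add E.scale E.zero)

text \<open>Moving \<open>E\<close> to the right past one \<open>F\<close> after the other collects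
  the weights \<open>N - 2q\<close>, \<open>N - 2q - 2\<close>, and so on; the first
  \<open>k + 1\<close> of them add up to \<open>(k + 1) (N - 2q - k)\<close>.\<close>

lemma E_Fpow:
  "u \<in> H q \<Longrightarrow> E ((F ^^ Suc k) u) = (of_nat (Suc k) * (of_nat N - 2 * of_nat q - of_nat k)) *s (F ^^ k) u"
proof (induction k)
  case 0
  then show ?case using EF_comm[of u q] by (simp add: H_def F.zero)
next
  case (Suc k)
  have X: "(F ^^ Suc k) u \<in> X (q + Suc k)" by (rule Fpow_X) (use Suc.prems in \<open>simp add: H_def\<close>)
  have "E ((F ^^ Suc (Suc k)) u) = E (F ((F ^^ Suc k) u))" by simp
  also have "\<dots> = F (E ((F ^^ Suc k) u)) + (of_nat N - 2 * of_nat (q + Suc k)) *s (F ^^ Suc k) u"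
    by (rule EF_comm[OF X])
  also have "F (E ((F ^^ Suc k) u)) = (of_nat (Suc k) * (of_nat N - 2 * of_nat q - of_nat k)) *s (F ^^ Suc k) u"
    unfolding Suc.IH[OF Suc.prems] F.scale by simp
  finally show ?case unfolding scale_left_distrib[symmetric]
    by (rule trans) (rule arg_cong[where f = "\<lambda>c. c *s (F ^^ Suc k) u"], simp add: algebra_simps)
qed

text \<open>Iterating \<open>E_Fpow\<close> gives a falling product from \<open>j\<close> and a
  rising one from \<open>N - 2q - j + 1\<close>. The bound \<open>2 * q + j \<le> N\<close> makes
  the truncated subtraction exact, so that both products are quotients of factorials, which are
  non-zero in characteristic zero.\<close>

lemma Epow_Fpow:
  assumes u: "u \<in> H q" and j: "2 * q + j \<le> N" and t: "t \<le> j"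
  shows "(E ^^ t) ((F ^^ j) u) =
    (fact j / fact (j - t) * (fact (N - 2*q - j + t) / fact (N - 2*q - j))) *s (F ^^ (j - t)) u"
  using t
proof (induction t)
  case 0 then show ?case by simp
next
  case (Suc t)
  let ?l = "N - 2*q - j"
  obtain m where m: "j - t = Suc m" "j - Suc t = m" using Suc.prems by (metis Suc_diff_Suc Suc_le_lessD)
  have m': "j = m + Suc t" using m Suc.prems by simp
  \<comment> \<open>The factor from \<open>E_Fpow\<close> is a difference in the field; it is a
    positive natural number, namely the next factor of the rising factorial.\<close>
  have c: "(of_nat N - 2 * of_nat q - of_nat m :: 'k) = of_nat (Suc (?l + t))"
  proof -
    have "Suc (?l + t) + m + 2 * q = N" using j m' by simp
    then have "(of_nat (Suc (?l + t) + m + 2 * q) :: 'k) = of_nat N" by metis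
    then show ?thesis by (simp add: algebra_simps)
  qed
  have "(E ^^ Suc t) ((F ^^ j) u) = E ((E ^^ t) ((F ^^ j) u))" by simp
  also have "\<dots> = (fact j / fact (Suc m) * (fact (?l + t) / fact ?l)) *s E ((F ^^ Suc m) u)"
    using Suc unfolding m(1) by (simp add: E.scale)
  also have "E ((F ^^ Suc m) u) = (of_nat (Suc m) * of_nat (Suc (?l + t))) *s (F ^^ m) u"
    unfolding E_Fpow[OF u] c ..
  also have "(fact j / fact (Suc m) * (fact (?l + t) / fact ?l)) *s (of_nat (Suc m) * of_nat (Suc (?l + t))) *s (F ^^ m) u
     = (fact j / fact m * (fact (?l + Suc t) / fact ?l)) *s (F ^^ m) u"
    unfolding scale_scale
  proof (rule arg_cong[where f = "\<lambda>c. c *s (F ^^ m) u"])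
    have "(of_nat (Suc m) :: 'k) \<noteq> 0" by (rule of_nat_neq_0)
    moreover have "fact (?l + Suc t) = (of_nat (Suc (?l + t)) * fact (?l + t) :: 'k)"
      by (simp add: algebra_simps)
    moreover have "fact (Suc m) = (of_nat (Suc m) * fact m :: 'k)" by simp
    ultimately show "fact j / fact (Suc m) * (fact (?l + t) / fact ?l) * (of_nat (Suc m) * of_nat (Suc (?l + t)))
       = (fact j / fact m * (fact (?l + Suc t) / fact ?l) :: 'k)"
      by (simp del: of_nat_Suc fact_Suc add: field_simps)
  qed
  finally show ?case unfolding m(2) .
qed

text \<open>\<open>E ^^ j\<close> brings \<open>(F ^^ j) u\<close> back to a multiple of
  \<open>u\<close>, which the next \<open>E\<close> kills.\<close>

lemma Epow_Fpow_0:
  assumes u: "u \<in> H q" and j: "2 * q + j \<le> N" and t: "j < t"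
  shows "(E ^^ t) ((F ^^ j) u) = 0"
proof -
  obtain m where m: "t = m + Suc j" using t by (metis add_Suc_right add.commute less_imp_Suc_add)
  have "(E ^^ j) ((F ^^ j) u) = (fact j * (fact (N - 2*q) / fact (N - 2*q - j))) *s u"
    using Epow_Fpow[OF u j, of j] j by simp
  then have "(E ^^ Suc j) ((F ^^ j) u) = 0" using u by (simp add: E.scale H_def)
  then show ?thesis unfolding m funpow_add comp_def by (simp add: Epow.zero)
qed

text \<open>Induction on an exponent \<open>m\<close> with \<open>(E ^^ m) v = 0\<close>. If
  \<open>E ^^ Suc m\<close> kills \<open>v\<close>, then \<open>(E ^^ m) v\<close> is a highest
  weight vector, and subtracting a suitable multiple of its image under \<open>F ^^ m\<close> leaves
  a vector killed by \<open>E ^^ m\<close>.\<close>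

lemma weight_decomposition:
  assumes "v \<in> X q" "2 * q \<le> N"
  shows "\<exists>u. (\<forall>j\<le>q. u j \<in> H (q - j)) \<and> v = (\<Sum>j\<le>q. (F ^^ j) (u j))"
proof -
  \<comment> \<open>The extra clause that components from \<open>m\<close> on vanish allows the
    induction step to insert the component \<open>m\<close> by a function update.\<close>
  have "\<exists>u. (\<forall>j\<le>q. u j \<in> H (q - j)) \<and> (\<forall>j\<ge>m. u j = 0) \<and> v = (\<Sum>j\<le>q. (F ^^ j) (u j))"
    if "v \<in> X q" "(E ^^ m) v = 0" "m \<le> Suc q" for m v
    using that
  proof (induction m arbitrary: v)
    case 0
    then show ?case
      by (intro exI[of _ "\<lambda>_. 0"]) (simp add: Fpow.zero subspace_0[OF subspace_H])
  next
    case (Suc m)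
    let ?w = "(E ^^ m) v"
    have mq: "m \<le> q" using Suc.prems by simp
    have "?w \<in> X (q - m)" by (rule Epow_X) (use Suc.prems mq in simp)
    with Suc.prems have w: "?w \<in> H (q - m)" by (simp add: H_def)
    \<comment> \<open>The scalar by which \<open>E ^^ m\<close> after \<open>F ^^ m\<close> acts on
      \<open>H (q - m)\<close>.\<close>
    define \<kappa> :: 'k where "\<kappa> = fact m * (fact (N - 2*(q-m)) / fact (N - 2*(q-m) - m))"
    have k0: "\<kappa> \<noteq> 0" by (simp add: \<kappa>_def)
    have l: "2 * (q - m) + m \<le> N" using assms mq by simp
    have Em: "(E ^^ m) ((F ^^ m) ?w) = \<kappa> *s ?w"
      using Epow_Fpow[OF w l order_refl] l by (simp add: \<kappa>_def)
    let ?v = "v - inverse \<kappa> *s (F ^^ m) ?w"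
    have "(F ^^ m) ?w \<in> X (q - m + m)" using w by (intro Fpow_X) (simp add: H_def)
    then have "?v \<in> X q" using Suc.prems mq by (intro subspace_diff subspace_scale subspace_X) auto
    moreover have "(E ^^ m) ?v = 0"
      unfolding Epow.diff Epow.scale Em using k0 by simp
    ultimately obtain u where u: "\<forall>j\<le>q. u j \<in> H (q - j)" "\<forall>j\<ge>m. u j = 0"
      and s: "?v = (\<Sum>j\<le>q. (F ^^ j) (u j))"
      using Suc.IH[of ?v] mq by auto
    let ?u = "u(m := inverse \<kappa> *s ?w)"
    have "(\<Sum>j\<le>q. (F ^^ j) (?u j)) = (F ^^ m) (?u m) + (\<Sum>j\<in>{..q} - {m}. (F ^^ j) (?u j))"
      by (rule sum.remove) (use mq in auto)
    also have "(\<Sum>j\<in>{..q} - {m}. (F ^^ j) (?u j)) = (\<Sum>j\<in>{..q} - {m}. (F ^^ j) (u j))"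
      by (rule sum.cong) auto
    also have "\<dots> = (\<Sum>j\<le>q. (F ^^ j) (u j))"
      using u(2) mq by (subst sum.remove[of "{..q}" m]) (auto simp: Fpow.zero)
    finally have "v = (\<Sum>j\<le>q. (F ^^ j) (?u j))" unfolding s[symmetric] by (simp add: Fpow.scale)
    moreover have "\<forall>j\<le>q. ?u j \<in> H (q - j)" using u(1) w by (simp add: subspace_scale subspace_H)
    moreover have "\<forall>j\<ge>Suc m. ?u j = 0" using u(2) by simp
    ultimately show ?case by blast
  qed
  \<comment> \<open>The induction is entered at \<open>Suc q\<close>, since
    \<open>E ^^ Suc q\<close> vanishes on all of \<open>X q\<close>.\<close>
  from this[of v "Suc q"] Epow_X0[of v q "Suc q"] assms show ?thesis by blast
qed

text \<open>Apply \<open>E ^^ m\<close> for the largest \<open>m\<close> with a non-zero component: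
  the summands below \<open>m\<close> are killed, those above are zero, and a non-zero multiple of
  \<open>u m\<close> remains.\<close>

lemma weight_independence:
  assumes u: "\<And>j. j \<le> q \<Longrightarrow> u j \<in> H (q - j)" and q: "2 * q \<le> N"
    and s: "(\<Sum>j\<le>q. (F ^^ j) (u j)) = 0" and k: "k \<le> q"
  shows "u k = 0"
proof (rule ccontr)
  assume nz: "u k \<noteq> 0"
  define m where "m = Max {j. j \<le> q \<and> u j \<noteq> 0}"
  have fin: "finite {j. j \<le> q \<and> u j \<noteq> 0}" by simp
  have "m \<in> {j. j \<le> q \<and> u j \<noteq> 0}" unfolding m_def using nz k fin by (intro Max_in) auto
  then have m: "m \<le> q" "u m \<noteq> 0" by auto
  have big: "u j = 0" if "j \<le> q" "j > m" for j
    using that Max_ge[OF fin, of j] unfolding m_def by fastforce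
  have "0 = (E ^^ m) (\<Sum>j\<le>q. (F ^^ j) (u j))" by (simp add: s Epow.zero)
  also have "\<dots> = (\<Sum>j\<le>q. (E ^^ m) ((F ^^ j) (u j)))" by (simp add: Epow.sum)
  also have "\<dots> = (E ^^ m) ((F ^^ m) (u m)) + (\<Sum>j\<in>{..q}-{m}. (E ^^ m) ((F ^^ j) (u j)))"
    by (rule sum.remove) (use m in auto)
  also have "(\<Sum>j\<in>{..q}-{m}. (E ^^ m) ((F ^^ j) (u j))) = 0"
  proof (rule sum.neutral, rule ballI)
    fix j assume "j \<in> {..q} - {m}"
    then consider "j \<le> q" "j < m" | "j \<le> q" "m < j" by fastforce
    then show "(E ^^ m) ((F ^^ j) (u j)) = 0"
    proof cases
      case 1 then show ?thesis using q by (intro Epow_Fpow_0[OF u]) auto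
    next
      case 2 then show ?thesis by (simp add: big Fpow.zero Epow.zero)
    qed
  qed
  also have "(E ^^ m) ((F ^^ m) (u m)) = (fact m * (fact (N - 2*(q-m)) / fact (N - 2*(q-m) - m))) *s u m"
    using Epow_Fpow[OF u[OF m(1)], of m m] q m(1) by simp
  finally show False using m(2) by simp
qed

lemma weight_unique:
  assumes u: "\<And>j. j \<le> q \<Longrightarrow> u j \<in> H (q - j)" and w: "\<And>j. j \<le> q \<Longrightarrow> w j \<in> H (q - j)"
    and q: "2 * q \<le> N" and s: "(\<Sum>j\<le>q. (F ^^ j) (u j)) = (\<Sum>j\<le>q. (F ^^ j) (w j))" and k: "k \<le> q"
  shows "u k = w k"
proof -
  have "u k - w k = 0"
  proof (rule weight_independence[where u = "\<lambda>j. u j - w j"])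
    show "\<And>j. j \<le> q \<Longrightarrow> u j - w j \<in> H (q - j)" using u w by (intro subspace_diff subspace_H)
    show "(\<Sum>j\<le>q. (F ^^ j) (u j - w j)) = 0" using s by (simp add: Fpow.diff sum_subtractf)
  qed (use q k in auto)
  then show ?thesis by simp
qed

end

lemma (in vector_space) injective_endomorphism_surjective:
  assumes S: "subspace S" and T: "finite T" "S \<subseteq> span T"
    and maps: "\<And>x. x \<in> S \<Longrightarrow> \<psi> x \<in> S"
    and lin: "\<And>c x y. x \<in> S \<Longrightarrow> y \<in> S \<Longrightarrow> \<psi> (scale c x + y) = scale c (\<psi> x) + \<psi> y"
    and ker: "\<And>x. x \<in> S \<Longrightarrow> \<psi> x = 0 \<Longrightarrow> x = 0"
  shows "\<psi> ` S = S"
proof -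
  interpret P: vector_space_pair scale scale ..
  obtain B where B: "B \<subseteq> S" "independent B" "S \<subseteq> span B" by (rule maximal_independent_subset)
  have finB: "finite B" using independent_span_bound[OF T(1) B(2)] B(1) T(2) by auto
  have spB: "span B = S" using B S by (simp add: span_subspace)
  \<comment> \<open>A globally linear \<open>f\<close> with the same values on a basis of
    \<open>S\<close> agrees with \<open>\<psi>\<close> on \<open>S\<close> and gives access to the
    theory of linear maps.\<close>
  obtain f where f: "Vector_Spaces.linear scale scale f" "\<And>x. x \<in> B \<Longrightarrow> f x = \<psi> x"
    using P.linear_independent_extend[OF B(2), of \<psi>] by blast
  interpret f: Vector_Spaces.linear scale scale f by (rule f(1))
  have z: "\<psi> 0 = 0" using lin[of 0 0 1] subspace_0[OF S] by simp
  have feq: "x \<in> S \<and> f x = \<psi> x" if "x \<in> span B" for x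
    using that
  proof (induction rule: span_induct_alt)
    case base then show ?case by (simp add: z f.zero subspace_0[OF S])
  next
    case (step c x y)
    then have "x \<in> S" using B(1) by auto
    with step show ?case
      by (simp add: f.add f.scale f(2) lin subspace_add[OF S] subspace_scale[OF S])
  qed
  have inj: "inj_on f (span B)"
  proof (rule inj_onI)
    fix x y assume xy: "x \<in> span B" "y \<in> span B" "f x = f y"
    then have d: "x - y \<in> span B" by (intro span_diff)
    then have "\<psi> (x - y) = 0" using feq[OF d] xy(3) by (simp add: f.diff)
    then show "x = y" using ker[of "x - y"] d spB by simp
  qed
  have ind: "independent (f ` B)" using f.independent_injective_image[OF B(2) inj] .
  have img: "f ` S \<subseteq> S" using feq spB maps by auto
  have card: "card (f ` B) = card B" using inj_on_subset[OF inj span_superset] by (rule card_image)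
  have "S \<subseteq> span (f ` B)"
  proof (rule ccontr)
    assume "\<not> S \<subseteq> span (f ` B)"
    then obtain y where y: "y \<in> S" "y \<notin> span (f ` B)" by blast
    \<comment> \<open>A vector of \<open>S\<close> outside the image would give
      \<open>card B + 1\<close> independent vectors in the span of \<open>B\<close>.\<close>
    have "independent (insert y (f ` B))" by (rule independent_insertI[OF y(2) ind])
    moreover have "insert y (f ` B) \<subseteq> span B" using y(1) img B(1) spB by auto
    ultimately have "card (insert y (f ` B)) \<le> card B" using independent_span_bound[OF finB] by blast
    moreover have "y \<notin> f ` B" using y(2) span_superset by blast
    ultimately show False using finB card by simp
  qed
  also have "span (f ` B) = f ` S" by (simp add: f.span_image spB)
  also have "f ` S = \<psi> ` S" using feq spB by (intro image_cong) auto
  finally show ?thesis using maps by blast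
qed

section \<open>Eigenvalues and image of \<open>Phi\<close>, and the relations of the Schur
  module\<close>

context sl2_weights
begin

text \<open>The combination of the maps \<open>\<theta>\<^sub>t \<circ> \<delta>\<^sub>t\<close>,
  written with divided powers: each of the two factors contributes one
  \<open>1 / fact t\<close>.\<close>

definition Phi :: "(nat \<Rightarrow> 'k) \<Rightarrow> nat \<Rightarrow> 'v \<Rightarrow> 'v" where
  "Phi c b v = (\<Sum>t\<le>b. (c t / (fact t * fact t)) *s (F ^^ t) ((E ^^ t) v))"

definition eig :: "(nat \<Rightarrow> 'k) \<Rightarrow> nat \<Rightarrow> nat \<Rightarrow> 'k" where
  "eig c b j = (\<Sum>t\<le>j. c t * (of_nat (j choose t) * of_nat ((N - 2*b + t + j) choose t)))"

lemma linear_Phi: "Vector_Spaces.linear scale scale (Phi c b)"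
  unfolding Vector_Spaces.linear_iff Phi_def
  by (auto simp: vector_space_axioms Epow.add Fpow.add Epow.scale Fpow.scale scale_right_distrib
      sum.distrib scale_sum_right mult.commute)

sublocale Phi: Vector_Spaces.linear scale scale "Phi c b" for c b by (rule linear_Phi)

text \<open>\<open>(E ^^ t) ((F ^^ j) u)\<close> is a multiple of \<open>(F ^^ (j - t)) u\<close>,
  and \<open>F ^^ t\<close> returns it to \<open>(F ^^ j) u\<close>. With
  \<open>l = N - 2b + j\<close> the scalar is \<open>j! / (j - t)!\<close> times
  \<open>(l + t)! / l!\<close>; division by \<open>t!\<close> twice turns it into the two binomial
  coefficients.\<close>

lemma Phi_Fpow:
  assumes b: "2 * b \<le> N" and j: "j \<le> b" and u: "u \<in> H (b - j)"
  shows "Phi c b ((F ^^ j) u) = eig c b j *s (F ^^ j) u"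
proof -
  have l: "2 * (b - j) + j \<le> N" using b j by simp
  have l': "N - 2 * (b - j) - j = N - 2 * b + j" using b j by simp
  have "Phi c b ((F ^^ j) u) = (\<Sum>t\<le>j. (c t / (fact t * fact t)) *s (F ^^ t) ((E ^^ t) ((F ^^ j) u)))"
    unfolding Phi_def
    \<comment> \<open>The terms with \<open>t > j\<close> vanish, which is why the eigenvalue only
      involves \<open>c t\<close> for \<open>t \<le> j\<close>.\<close>
    by (rule sum.mono_neutral_right) (use j Epow_Fpow_0[OF u l] in \<open>auto simp: Fpow.zero\<close>)
  also have "\<dots> = (\<Sum>t\<le>j. (c t * (of_nat (j choose t) * of_nat ((N - 2*b + t + j) choose t))) *s (F ^^ j) u)"
  proof (rule sum.cong[OF refl])
    fix t assume "t \<in> {..j}"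
    then have t: "t \<le> j" by simp
    let ?l = "N - 2 * b + j"
    have 1: "(of_nat (j choose t) :: 'k) = fact j / (fact t * fact (j - t))"
      by (rule binomial_fact[OF t])
    have 2: "(of_nat ((N - 2*b + t + j) choose t) :: 'k) = fact (?l + t) / (fact t * fact ?l)"
      by (subst binomial_fact) (simp_all add: ac_simps)
    have "(F ^^ t) ((E ^^ t) ((F ^^ j) u))
        = (fact j / fact (j - t) * (fact (?l + t) / fact ?l)) *s (F ^^ t) ((F ^^ (j - t)) u)"
      unfolding Epow_Fpow[OF u l t] l' Fpow.scale ..
    also have "(F ^^ t) ((F ^^ (j - t)) u) = (F ^^ j) u"
      using t by (simp add: funpow_add[unfolded comp_def fun_eq_iff, rule_format, symmetric])
    finally show "(c t / (fact t * fact t)) *s (F ^^ t) ((E ^^ t) ((F ^^ j) u)) =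
       (c t * (of_nat (j choose t) * of_nat ((N - 2*b + t + j) choose t))) *s (F ^^ j) u"
      unfolding 1 2 by simp
  qed
  finally show ?thesis unfolding eig_def scale_sum_left .
qed

lemma Phi_sum:
  assumes b: "2 * b \<le> N" and u: "\<And>j. j \<le> b \<Longrightarrow> u j \<in> H (b - j)"
  shows "Phi c b (\<Sum>j\<le>b. (F ^^ j) (u j)) = (\<Sum>j\<le>b. (F ^^ j) (eig c b j *s u j))"
  unfolding Phi.sum by (rule sum.cong) (use Phi_Fpow[OF b] u in \<open>auto simp: Fpow.scale\<close>)

lemma sum_Fpow_X:
  assumes "\<And>j. j \<le> q \<Longrightarrow> u j \<in> H (q - j)"
  shows "(\<Sum>j\<le>q. (F ^^ j) (u j)) \<in> X q"
proof (rule subspace_sum[OF subspace_X])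
  fix j assume "j \<in> {..q}"
  then have "(F ^^ j) (u j) \<in> X (q - j + j)" using assms[of j] by (intro Fpow_X) (simp add: H_def)
  then show "(F ^^ j) (u j) \<in> X q" using \<open>j \<in> {..q}\<close> by simp
qed

text \<open>\<open>Phi\<close> is diagonal with respect to the unique decomposition of
  \<open>X b\<close>, so its image is the sum of the summands with non-zero eigenvalue.\<close>

lemma mem_Phi_image_iff:
  assumes b: "2 * b \<le> N" and u: "\<And>j. j \<le> b \<Longrightarrow> u j \<in> H (b - j)"
  shows "(\<Sum>j\<le>b. (F ^^ j) (u j)) \<in> Phi c b ` X b \<longleftrightarrow> (\<forall>j\<le>b. eig c b j = 0 \<longrightarrow> u j = 0)"
proof
  assume "(\<Sum>j\<le>b. (F ^^ j) (u j)) \<in> Phi c b ` X b"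
  then obtain x where x: "x \<in> X b" "(\<Sum>j\<le>b. (F ^^ j) (u j)) = Phi c b x" by blast
  from weight_decomposition[OF x(1) b] obtain w where w: "\<And>j. j \<le> b \<Longrightarrow> w j \<in> H (b - j)"
    "x = (\<Sum>j\<le>b. (F ^^ j) (w j))" by blast
  have "(\<Sum>j\<le>b. (F ^^ j) (u j)) = (\<Sum>j\<le>b. (F ^^ j) (eig c b j *s w j))"
    unfolding x(2) w(2) by (rule Phi_sum[OF b w(1)])
  then have "u j = eig c b j *s w j" if "j \<le> b" for j
    using that weight_unique[of b u "\<lambda>j. eig c b j *s w j" j] u w b
    by (simp add: subspace_scale subspace_H)
  then show "\<forall>j\<le>b. eig c b j = 0 \<longrightarrow> u j = 0" by simp
next
  assume z: "\<forall>j\<le>b. eig c b j = 0 \<longrightarrow> u j = 0"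
  \<comment> \<open>Where the eigenvalue is zero, \<open>inverse\<close> returns 0; this is harmless
    because the component \<open>u j\<close> is zero there as well.\<close>
  let ?w = "\<lambda>j. inverse (eig c b j) *s u j"
  have w: "\<And>j. j \<le> b \<Longrightarrow> ?w j \<in> H (b - j)" using u by (simp add: subspace_scale subspace_H)
  have "Phi c b (\<Sum>j\<le>b. (F ^^ j) (?w j)) = (\<Sum>j\<le>b. (F ^^ j) (eig c b j *s ?w j))"
    by (rule Phi_sum[OF b w])
  also have "\<dots> = (\<Sum>j\<le>b. (F ^^ j) (u j))"
    by (rule sum.cong) (use z in \<open>auto simp: Fpow.scale Fpow.zero\<close>)
  finally show "(\<Sum>j\<le>b. (F ^^ j) (u j)) \<in> Phi c b ` X b"
    using sum_Fpow_X[OF w] by (intro image_eqI[where f = "Phi c b"]) simp_all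
qed

text \<open>The image of \<open>\<theta>\<^sub>1\<close> in \<open>X q\<close>, whose cokernel is
  the Schur module. The case \<open>q = 0\<close> is separate because \<open>q - 1\<close> would be
  0 again instead of naming a zero space.\<close>

definition rel :: "nat \<Rightarrow> 'v set" where
  "rel q = (if q = 0 then {0} else F ` X (q - 1))"

lemma subspace_rel: "subspace (rel q)"
  by (simp add: rel_def F.subspace_image subspace_X subspace_single_0)

lemma rel_X: "rel q \<subseteq> X q"
  using F_X[of _ "q - 1"] subspace_0[OF subspace_X] by (auto simp: rel_def)

text \<open>\<open>F\<close> shifts the component of index \<open>j\<close> to index
  \<open>j + 1\<close>, so exactly the sums without a component of index 0 are hit. Hence
  \<open>X q\<close> is the direct sum of \<open>H q\<close> and \<open>rel q\<close>.\<close>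

lemma mem_rel_iff:
  assumes q: "2 * q \<le> N" and u: "\<And>j. j \<le> q \<Longrightarrow> u j \<in> H (q - j)"
  shows "(\<Sum>j\<le>q. (F ^^ j) (u j)) \<in> rel q \<longleftrightarrow> u 0 = 0"
proof (cases q)
  case 0 then show ?thesis by (simp add: rel_def)
next
  case (Suc p)
  show ?thesis
  proof
    assume "(\<Sum>j\<le>q. (F ^^ j) (u j)) \<in> rel q"
    then obtain x where x: "x \<in> X p" "(\<Sum>j\<le>q. (F ^^ j) (u j)) = F x" unfolding rel_def Suc by auto
    from weight_decomposition[OF x(1)] q Suc obtain w where w: "\<And>j. j \<le> p \<Longrightarrow> w j \<in> H (p - j)"
      "x = (\<Sum>j\<le>p. (F ^^ j) (w j))" by auto
    \<comment> \<open>The components of \<open>F x\<close>: those of \<open>x\<close> shifted by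
      one, with 0 in front.\<close>
    let ?w = "\<lambda>j. case j of 0 \<Rightarrow> 0 | Suc j \<Rightarrow> w j"
    have "F x = (\<Sum>j\<le>q. (F ^^ j) (?w j))"
      unfolding w(2) F.sum Suc sum.atMost_Suc_shift by simp
    with x(2) have "(\<Sum>j\<le>q. (F ^^ j) (u j)) = (\<Sum>j\<le>q. (F ^^ j) (?w j))" by simp
    then have "u 0 = ?w 0"
      using u w q by (intro weight_unique[of q u ?w])
        (auto simp: Suc subspace_0[OF subspace_H] split: nat.split)
    then show "u 0 = 0" by simp
  next
    assume "u 0 = 0"
    then have "(\<Sum>j\<le>q. (F ^^ j) (u j)) = F (\<Sum>j\<le>p. (F ^^ j) (u (Suc j)))"
      unfolding F.sum Suc sum.atMost_Suc_shift by simp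
    moreover have "(\<Sum>j\<le>p. (F ^^ j) (u (Suc j))) \<in> X p"
      using u[of "Suc _"] by (intro sum_Fpow_X) (simp add: Suc)
    ultimately show "(\<Sum>j\<le>q. (F ^^ j) (u j)) \<in> rel q" by (simp add: rel_def Suc)
  qed
qed

text \<open>Presents a vector of a single summand as a full sum, so that the membership criteria
  apply to it.\<close>

lemma single_sum:
  "j \<le> q \<Longrightarrow> (\<Sum>k\<le>q. (F ^^ k) (if k = j then u else 0)) = (F ^^ j) u"
proof -
  assume "j \<le> q"
  have "(\<Sum>k\<le>q. (F ^^ k) (if k = j then u else 0)) = (\<Sum>k\<le>q. if k = j then (F ^^ k) u else 0)"
    by (rule sum.cong) (auto simp: Fpow.zero)
  then show ?thesis using \<open>j \<le> q\<close> by simp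
qed

lemma H_rel: "2 * q \<le> N \<Longrightarrow> u \<in> H q \<Longrightarrow> u \<in> rel q \<Longrightarrow> u = 0"
  using mem_rel_iff[of q "\<lambda>k. if k = 0 then u else 0"] single_sum[of 0 q u]
  by (auto simp: subspace_0[OF subspace_H])

lemma Fpow_mem_Phi_image:
  assumes "2 * b \<le> N" "j \<le> b" "u \<in> H (b - j)"
  shows "(F ^^ j) u \<in> Phi c b ` X b \<longleftrightarrow> eig c b j \<noteq> 0 \<or> u = 0"
  using mem_Phi_image_iff[of b "\<lambda>k. if k = j then u else 0" c] single_sum[of j b u] assms
  by (auto simp: subspace_0[OF subspace_H])

section \<open>Components and operators that commute with the action\<close>

definition comps :: "nat \<Rightarrow> 'v \<Rightarrow> nat \<Rightarrow> 'v" where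
  "comps q v = (SOME u. (\<forall>j\<le>q. u j \<in> H (q - j)) \<and> v = (\<Sum>j\<le>q. (F ^^ j) (u j)))"

lemma comps:
  assumes "2 * q \<le> N" "v \<in> X q"
  shows "j \<le> q \<Longrightarrow> comps q v j \<in> H (q - j)" and "(\<Sum>j\<le>q. (F ^^ j) (comps q v j)) = v"
  using someI_ex[OF weight_decomposition[OF assms(2,1)]] unfolding comps_def by auto

lemma comps_eq:
  assumes q: "2 * q \<le> N" and u: "\<And>j. j \<le> q \<Longrightarrow> u j \<in> H (q - j)" and k: "k \<le> q"
  shows "comps q (\<Sum>j\<le>q. (F ^^ j) (u j)) k = u k"
  using comps[OF q sum_Fpow_X[OF u]] by (intro weight_unique[OF _ u q _ k]) auto

text \<open>Group elements enter the abstract argument only through such operators, one at a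
  time.\<close>

definition equivariant :: "('v \<Rightarrow> 'v) \<Rightarrow> bool" where
  "equivariant g \<longleftrightarrow> Vector_Spaces.linear scale scale g \<and>
     (\<forall>q. \<forall>v\<in>X q. g v \<in> X q \<and> g (E v) = E (g v) \<and> g (F v) = F (g v))"

lemma equivariant_H: "equivariant g \<Longrightarrow> u \<in> H q \<Longrightarrow> g u \<in> H q"
proof -
  assume g: "equivariant g" and u: "u \<in> H q"
  then interpret g: Vector_Spaces.linear scale scale g by (simp add: equivariant_def)
  have "u \<in> X q" using u by (simp add: H_def)
  with g have "g (E u) = E (g u)" "g u \<in> X q" unfolding equivariant_def by blast+
  with u show ?thesis by (simp add: H_def g.zero)
qed

lemma equivariant_Fpow: "equivariant g \<Longrightarrow> u \<in> X q \<Longrightarrow> g ((F ^^ j) u) = (F ^^ j) (g u)"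
proof (induction j)
  case (Suc j)
  have "g (F ((F ^^ j) u)) = F (g ((F ^^ j) u))"
    using Suc.prems Fpow_X[of u q j] unfolding equivariant_def by blast
  then show ?case using Suc by simp
qed simp

lemma equivariant_sum:
  assumes g: "equivariant g" and u: "\<And>j. j \<le> q \<Longrightarrow> u j \<in> H (q - j)"
  shows "g (\<Sum>j\<le>q. (F ^^ j) (u j)) = (\<Sum>j\<le>q. (F ^^ j) (g (u j)))"
proof -
  interpret g: Vector_Spaces.linear scale scale g using g by (simp add: equivariant_def)
  show ?thesis unfolding g.sum
    by (rule sum.cong) (use u equivariant_Fpow[OF g] in \<open>auto simp: H_def\<close>)
qed

text \<open>The map is the projection of \<open>v\<close> to its component
  \<open>comps b v i\<close>. Its kernel is the sum of the other summands, which is the image of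
  \<open>Phi\<close> when only the \<open>i\<close>-th eigenvalue vanishes, and its values lie in
  \<open>H (b - i)\<close>, a complement of \<open>rel (b - i)\<close>.\<close>

lemma coker_map:
  assumes b: "2 * b \<le> N" and i: "i \<le> b" and ei: "eig c b i = 0"
    and ej: "\<And>j. j \<le> b \<Longrightarrow> j \<noteq> i \<Longrightarrow> eig c b j \<noteq> 0"
  obtains \<phi> where "\<And>v. v \<in> X b \<Longrightarrow> \<phi> v \<in> X (b - i)"
    and "\<And>a u v. u \<in> X b \<Longrightarrow> v \<in> X b \<Longrightarrow> \<phi> (a *s u + v) = a *s \<phi> u + \<phi> v"
    and "\<And>v. v \<in> X b \<Longrightarrow> \<phi> v \<in> rel (b - i) \<longleftrightarrow> v \<in> Phi c b ` X b"
    and "\<And>w. w \<in> X (b - i) \<Longrightarrow> \<exists>v\<in>X b. \<phi> v - w \<in> rel (b - i)"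
    and "\<And>g v. equivariant g \<Longrightarrow> v \<in> X b \<Longrightarrow> \<phi> (g v) = g (\<phi> v)"
proof (rule that[of "\<lambda>v. comps b v i"])
  fix v assume v: "v \<in> X b"
  note cv = comps[OF b v]
  from cv(1)[OF i] show "comps b v i \<in> X (b - i)" by (simp add: H_def)
  have "v \<in> Phi c b ` X b \<longleftrightarrow> comps b v i = 0"
    using mem_Phi_image_iff[OF b cv(1), of c] cv(2) i ei ej by auto
  also have "\<dots> \<longleftrightarrow> comps b v i \<in> rel (b - i)"
    using H_rel[OF _ cv(1)[OF i]] b subspace_0[OF subspace_rel] by auto
  finally show "comps b v i \<in> rel (b - i) \<longleftrightarrow> v \<in> Phi c b ` X b" ..
  fix a u assume u: "u \<in> X b"
  note cu = comps[OF b u]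
  have "(\<Sum>j\<le>b. (F ^^ j) (a *s comps b u j + comps b v j)) = a *s u + v"
    by (simp add: Fpow.add Fpow.scale sum.distrib scale_sum_right[symmetric] cu cv)
  then show "comps b (a *s u + v) i = a *s comps b u i + comps b v i"
    using comps_eq[OF b, of "\<lambda>j. a *s comps b u j + comps b v j" i] cu(1) cv(1) i
    by (simp add: subspace_add subspace_scale subspace_H)
next
  fix w assume w: "w \<in> X (b - i)"
  have bi: "2 * (b - i) \<le> N" using b by simp
  note cw = comps[OF bi w]
  \<comment> \<open>Modulo \<open>rel (b - i)\<close> the vector \<open>w\<close> equals its highest
    weight component, which is the image of \<open>(F ^^ i) ?u\<close>.\<close>
  let ?u = "comps (b - i) w 0"
  have u: "?u \<in> H (b - i)" using cw(1)[of 0] by simp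
  have "comps b ((F ^^ i) ?u) i = ?u"
    using comps_eq[OF b, of "\<lambda>k. if k = i then ?u else 0" i] single_sum[OF i] u i
    by (auto simp: subspace_0[OF subspace_H])
  moreover have "?u - w \<in> rel (b - i)"
  proof -
    let ?d = "\<lambda>k. (if k = 0 then ?u else 0) - comps (b - i) w k"
    have "(\<Sum>k\<le>b - i. (F ^^ k) (?d k)) = ?u - w"
      unfolding Fpow.diff sum_subtractf cw(2) using single_sum[of 0 "b - i" ?u] by simp
    moreover have "?d k \<in> H (b - i - k)" if "k \<le> b - i" for k
      using cw(1)[OF that] u by (intro subspace_diff subspace_H) (auto simp: subspace_0[OF subspace_H])
    ultimately show ?thesis using mem_rel_iff[OF bi, of ?d] by simp
  qed
  moreover have "(F ^^ i) ?u \<in> X b" using Fpow_X[of ?u "b - i" i] u i by (simp add: H_def)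
  ultimately show "\<exists>v\<in>X b. comps b v i - w \<in> rel (b - i)" by metis
next
  fix g v assume g: "equivariant g" and v: "v \<in> X b"
  note cv = comps[OF b v]
  \<comment> \<open>As \<open>g\<close> preserves every \<open>H q\<close> and commutes with
    \<open>F\<close>, it maps components to components.\<close>
  have "g v = (\<Sum>j\<le>b. (F ^^ j) (g (comps b v j)))"
    using equivariant_sum[OF g, of b "comps b v"] cv by simp
  then show "comps b (g v) i = g (comps b v i)"
    using comps_eq[OF b, of "\<lambda>j. g (comps b v j)" i] equivariant_H[OF g] cv(1) i by simp
qed

text \<open>The relation \<open>\<rho>\<close> says that two vectors represent classes matched by an
  isomorphism of the cokernels. One operator \<open>g\<close> suffices: \<open>e j\<close> is a
  highest weight vector with eigenvalue \<open>\<omega> j\<close>, and \<open>dominance\<close> says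
  that this eigenvalue occurs in \<open>X (b - k)\<close> only for \<open>k \<le> j\<close>.
  Carrying eigenvectors across in both directions identifies \<open>i\<close> as the least index of
  a vanishing eigenvalue; a dimension count shows that there is no other.\<close>

lemma coker_iso_imp_eig:
  assumes b: "2 * b \<le> N" and i: "i \<le> b"
    and g: "equivariant g"
    and e: "\<And>j. j \<le> b \<Longrightarrow> e j \<in> H (b - j)" "\<And>j. j \<le> b \<Longrightarrow> e j \<noteq> 0"
      "\<And>j. j \<le> b \<Longrightarrow> g (e j) = \<omega> j *s e j"
    and dominance: "\<And>j k v. j \<le> b \<Longrightarrow> k \<le> b \<Longrightarrow> v \<in> X (b - k) \<Longrightarrow> g v = \<omega> j *s v \<Longrightarrow> v \<noteq> 0 \<Longrightarrow> k \<le> j"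
    and fin: "finite T" "X (b - i) \<subseteq> span T"
    and left_total: "\<And>v. v \<in> X b \<Longrightarrow> \<exists>v'\<in>X (b - i). \<rho> v v'"
    and right_total: "\<And>v'. v' \<in> X (b - i) \<Longrightarrow> \<exists>v\<in>X b. \<rho> v v'"
    and lin: "\<And>a u v u' v'. u \<in> X b \<Longrightarrow> v \<in> X b \<Longrightarrow> u' \<in> X (b - i) \<Longrightarrow> v' \<in> X (b - i) \<Longrightarrow>
       \<rho> u u' \<Longrightarrow> \<rho> v v' \<Longrightarrow> \<rho> (a *s u + v) (a *s u' + v')"
    and mem: "\<And>v v'. v \<in> X b \<Longrightarrow> v' \<in> X (b - i) \<Longrightarrow> \<rho> v v' \<Longrightarrow> v \<in> Phi c b ` X b \<longleftrightarrow> v' \<in> rel (b - i)"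
    and zero: "\<And>w w'. w \<in> Phi c b ` X b \<Longrightarrow> w' \<in> rel (b - i) \<Longrightarrow> \<rho> w w'"
    and equiv: "\<And>v v'. v \<in> X b \<Longrightarrow> v' \<in> X (b - i) \<Longrightarrow> \<rho> v v' \<Longrightarrow> \<rho> (g v) (g v')"
  shows "eig c b i = 0 \<and> (\<forall>j\<le>b. j \<noteq> i \<longrightarrow> eig c b j \<noteq> 0)"
proof -
  interpret g: Vector_Spaces.linear scale scale g using g by (simp add: equivariant_def)
  let ?W = "Phi c b ` X b" and ?R = "rel (b - i)"
  have bi: "2 * (b - i) \<le> N" using b by simp
  have gX: "\<And>v q. v \<in> X q \<Longrightarrow> g v \<in> X q" using g by (simp add: equivariant_def)
  have HX: "\<And>v q. v \<in> H q \<Longrightarrow> v \<in> X q" by (simp add: H_def)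
  have FX: "(F ^^ j) u \<in> X b" if "u \<in> H (b - j)" "j \<le> b" for u j
    using Fpow_X[OF HX[OF that(1)], of j] that(2) by simp
  have WX: "?W \<subseteq> X b"
  proof safe
    fix v assume v: "v \<in> X b"
    have "\<And>j. j \<le> b \<Longrightarrow> eig c b j *s comps b v j \<in> H (b - j)"
      using comps(1)[OF b v] by (simp add: subspace_scale subspace_H)
    from sum_Fpow_X[OF this] Phi_sum[OF b comps(1)[OF b v]] show "Phi c b v \<in> X b"
      by (simp add: comps(2)[OF b v])
  qed
  have sub: "\<rho> (u - a *s v) (u' - a *s v')"
    if "u \<in> X b" "v \<in> X b" "u' \<in> X (b - i)" "v' \<in> X (b - i)" "\<rho> u u'" "\<rho> v v'" for a u v u' v'
    using lin[of v u v' u' "- a"] that by simp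
  \<comment> \<open>This and \<open>uniq\<close> below: among the partners of \<open>v\<close>
    exactly one lies in \<open>H (b - i)\<close>, because \<open>H (b - i)\<close> is a complement
    of \<open>rel (b - i)\<close>.\<close>
  have norm: "\<exists>h\<in>H (b - i). \<rho> v h" if v: "v \<in> X b" for v
  proof -
    obtain v' where v': "v' \<in> X (b - i)" "\<rho> v v'" using left_total[OF v] by blast
    let ?h = "comps (b - i) v' 0"
    have h: "?h \<in> H (b - i)" using comps(1)[OF bi v'(1), of 0] by simp
    let ?d = "\<lambda>k. comps (b - i) v' k - (if k = 0 then ?h else 0)"
    have "(\<Sum>k\<le>b - i. (F ^^ k) (?d k)) = v' - ?h"
      unfolding Fpow.diff sum_subtractf comps(2)[OF bi v'(1)] using single_sum[of 0 "b - i" ?h] by simp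
    moreover have "?d k \<in> H (b - i - k)" if "k \<le> b - i" for k
      using comps(1)[OF bi v'(1) that] h by (intro subspace_diff subspace_H) (auto simp: subspace_0[OF subspace_H])
    ultimately have "v' - ?h \<in> ?R" using mem_rel_iff[OF bi, of ?d] by simp
    moreover have "0 \<in> ?W" using Phi.zero subspace_0[OF subspace_X] by (metis imageI)
    ultimately have "\<rho> 0 (v' - ?h)" by (intro zero)
    moreover have "v' - ?h \<in> X (b - i)" using \<open>v' - ?h \<in> ?R\<close> rel_X by blast
    ultimately have "\<rho> (v - 1 *s 0) (v' - 1 *s (v' - ?h))"
      using v v' subspace_0[OF subspace_X] by (intro sub)
    then show ?thesis using h by auto
  qed
  have uniq: "h = h'" if "h \<in> H (b - i)" "h' \<in> H (b - i)" "\<rho> v h" "\<rho> v h'" "v \<in> X b" for v h h'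
  proof -
    have "\<rho> (v - 1 *s v) (h - 1 *s h')" using that HX by (intro sub) auto
    moreover have "v - 1 *s v \<in> ?W" using Phi.zero subspace_0[OF subspace_X] by (metis imageI right_minus_eq scale_one)
    moreover have "h - 1 *s h' \<in> H (b - i)" using that by (simp add: subspace_diff subspace_H)
    ultimately have "h - 1 *s h' \<in> ?R" using mem HX WX by blast
    from H_rel[OF bi \<open>h - 1 *s h' \<in> H (b - i)\<close> this] show ?thesis by simp
  qed
  \<comment> \<open>If the eigenvalue of index \<open>j\<close> vanishes,
    \<open>(F ^^ j) (e j)\<close> has a non-zero class. Its partner in \<open>H (b - i)\<close> is a
    non-zero eigenvector of \<open>g\<close> for \<open>\<omega> j\<close>, and
    \<open>dominance\<close> applies.\<close>
  have ge: "i \<le> j" if j: "j \<le> b" "eig c b j = 0" for j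
  proof -
    let ?v = "(F ^^ j) (e j)"
    have v: "?v \<in> X b" by (rule FX[OF e(1)[OF j(1)] j(1)])
    have gv: "g ?v = \<omega> j *s ?v"
      using equivariant_Fpow[OF g HX[OF e(1)[OF j(1)]]] e(3)[OF j(1)] by (simp add: Fpow.scale)
    obtain h where h: "h \<in> H (b - i)" "\<rho> ?v h" using norm[OF v] by blast
    have "\<rho> (g ?v) (g h)" using equiv v h HX by blast
    moreover have "\<rho> (\<omega> j *s ?v) (\<omega> j *s h)"
    proof -
      have "0 \<in> ?W" using Phi.zero subspace_0[OF subspace_X] by (metis imageI)
      then have "\<rho> 0 0" by (rule zero[OF _ subspace_0[OF subspace_rel]])
      then have "\<rho> (\<omega> j *s ?v + 0) (\<omega> j *s h + 0)"
        using v h HX subspace_0[OF subspace_X] by (intro lin)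
      then show ?thesis by simp
    qed
    ultimately have "g h = \<omega> j *s h"
      using uniq[of "g h" "\<omega> j *s h" "\<omega> j *s ?v"] gv h v equivariant_H[OF g h(1)]
      by (simp add: subspace_scale subspace_H subspace_X)
    moreover have "h \<noteq> 0"
    proof
      assume "h = 0"
      then have "?v \<in> ?W" using mem[OF v _ h(2)] subspace_0[OF subspace_X] subspace_0[OF subspace_rel] by blast
      then show False using Fpow_mem_Phi_image[OF b j(1) e(1)[OF j(1)]] j(2) e(2)[OF j(1)] by simp
    qed
    ultimately show ?thesis using dominance[OF j(1) i HX[OF h(1)]] by blast
  qed
  \<comment> \<open>In the other direction, a partner \<open>v\<close> of \<open>e i\<close> is an
    eigenvector for \<open>\<omega> i\<close> modulo the image of \<open>Phi\<close>. The components
    of \<open>v\<close> at vanishing eigenvalues are therefore true eigenvectors, and one of them is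
    non-zero.\<close>
  have le: "\<exists>k\<le>i. eig c b k = 0"
  proof -
    have eiX: "e i \<in> X (b - i)" using e(1)[OF i] HX by blast
    obtain v where v: "v \<in> X b" "\<rho> v (e i)" using right_total[OF eiX] by blast
    note cv = comps[OF b v(1)]
    have "\<rho> (g v - \<omega> i *s v) (g (e i) - \<omega> i *s e i)"
      using v eiX gX equiv by (intro sub) auto
    then have "g v - \<omega> i *s v \<in> ?W"
      using mem[of "g v - \<omega> i *s v" "g (e i) - \<omega> i *s e i"] v(1) gX e(3)[OF i]
        subspace_0[OF subspace_X] subspace_0[OF subspace_rel]
      by (simp add: subspace_diff subspace_scale subspace_X)
    moreover have "(\<Sum>j\<le>b. (F ^^ j) (g (comps b v j) - \<omega> i *s comps b v j)) = g v - \<omega> i *s v"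
      using equivariant_sum[OF g cv(1)] cv(2)
      by (simp add: Fpow.diff Fpow.scale sum_subtractf scale_sum_right[symmetric])
    ultimately have gk: "g (comps b v k) = \<omega> i *s comps b v k" if "k \<le> b" "eig c b k = 0" for k
      using mem_Phi_image_iff[OF b, of "\<lambda>j. g (comps b v j) - \<omega> i *s comps b v j" c] that cv(1)
        equivariant_H[OF g] by (simp add: subspace_diff subspace_scale subspace_H)
    have "v \<notin> ?W"
      using mem[OF v(1) eiX v(2)] H_rel[OF bi e(1)[OF i]] e(2)[OF i] by blast
    then obtain k where k: "k \<le> b" "eig c b k = 0" "comps b v k \<noteq> 0"
      using mem_Phi_image_iff[OF b cv(1), of c] cv(2) by auto
    then show ?thesis using dominance[OF i k(1) HX[OF cv(1)[OF k(1)]] gk] by blast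
  qed
  have ei: "eig c b i = 0" using le ge i by (metis le_antisym le_trans)
  moreover have "eig c b j \<noteq> 0" if j: "j \<le> b" "j \<noteq> i" for j
  proof
    assume ej: "eig c b j = 0"
    \<comment> \<open>The isomorphism restricted to the summand \<open>(F ^^ i) (H (b - i))\<close>,
      read as a self-map of \<open>H (b - i)\<close>. Uniqueness of the partner makes it linear and
      the vanishing of \<open>eig c b i\<close> makes it injective, hence it is surjective.\<close>
    define \<psi> where "\<psi> u = (SOME h. h \<in> H (b - i) \<and> \<rho> ((F ^^ i) u) h)" for u
    have \<psi>: "\<psi> u \<in> H (b - i)" "\<rho> ((F ^^ i) u) (\<psi> u)" if "u \<in> H (b - i)" for u
      using someI_ex[OF norm[OF FX[OF that i], unfolded Bex_def]] unfolding \<psi>_def by auto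
    have "\<psi> ` H (b - i) = H (b - i)"
    proof (rule injective_endomorphism_surjective[OF subspace_H fin(1)])
      show "H (b - i) \<subseteq> span T" using fin(2) HX by blast
      show "\<psi> u \<in> H (b - i)" if "u \<in> H (b - i)" for u using \<psi>(1)[OF that] .
      show "\<psi> (a *s x + y) = a *s \<psi> x + \<psi> y" if x: "x \<in> H (b - i)" and y: "y \<in> H (b - i)" for a x y
      proof -
        have xy: "a *s x + y \<in> H (b - i)" using x y by (simp add: subspace_add subspace_scale subspace_H)
        have "\<rho> (a *s (F ^^ i) x + (F ^^ i) y) (a *s \<psi> x + \<psi> y)"
          using x y \<psi> FX i HX by (intro lin) auto
        moreover have "a *s \<psi> x + \<psi> y \<in> H (b - i)"
          using \<psi>(1) x y by (simp add: subspace_add subspace_scale subspace_H)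
        ultimately show ?thesis using uniq[OF \<psi>(1)[OF xy] _ \<psi>(2)[OF xy] _ FX[OF xy i]]
          by (simp add: Fpow.add Fpow.scale)
      qed
      show "u = 0" if u: "u \<in> H (b - i)" and z: "\<psi> u = 0" for u
      proof -
        have "(F ^^ i) u \<in> ?W"
          using mem[OF FX[OF u i] _ \<psi>(2)[OF u]] z subspace_0[OF subspace_X] subspace_0[OF subspace_rel] by simp
        then show ?thesis using Fpow_mem_Phi_image[OF b i u] ei by simp
      qed
    qed
    moreover have v: "(F ^^ j) (e j) \<in> X b" by (rule FX[OF e(1)[OF j(1)] j(1)])
    obtain h where h: "h \<in> H (b - i)" "\<rho> ((F ^^ j) (e j)) h" using norm[OF v] by blast
    ultimately obtain u where u: "u \<in> H (b - i)" "\<psi> u = h" by (metis imageE)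
    \<comment> \<open>By surjectivity the class of \<open>(F ^^ j) (e j)\<close> already comes from
      the \<open>i\<close>-th summand, against the directness of the sum when \<open>j\<close> also
      has eigenvalue zero.\<close>
    have "\<rho> ((F ^^ j) (e j) - 1 *s (F ^^ i) u) (h - 1 *s \<psi> u)"
      using v h u \<psi> HX FX i by (intro sub) auto
    then have "(F ^^ j) (e j) - (F ^^ i) u \<in> ?W"
      using mem[of "(F ^^ j) (e j) - (F ^^ i) u" 0] v FX[OF u(1) i] u(2)
        subspace_0[OF subspace_X] subspace_0[OF subspace_rel]
      by (simp add: subspace_diff subspace_X)
    moreover
    let ?d = "\<lambda>k. (if k = j then e j else 0) - (if k = i then u else 0)"
    have "(\<Sum>k\<le>b. (F ^^ k) (?d k)) = (F ^^ j) (e j) - (F ^^ i) u"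
      unfolding Fpow.diff sum_subtractf single_sum[OF j(1)] single_sum[OF i] ..
    moreover have "?d k \<in> H (b - k)" if "k \<le> b" for k
      using e(1) u(1) that by (intro subspace_diff subspace_H) (auto simp: subspace_0[OF subspace_H])
    ultimately have "\<forall>k\<le>b. eig c b k = 0 \<longrightarrow> ?d k = 0"
      using mem_Phi_image_iff[OF b, of ?d c] by simp
    with ej j have "e j = 0" by auto
    then show False using e(2)[OF j(1)] by simp
  qed
  ultimately show ?thesis by blast
qed

end

section \<open>The operators on pairs of subsets\<close>

text \<open>Scaling as a function of its own, so that function spaces can be fed to the
  \<open>vector_space\<close> locale.\<close>

definition fscale :: "'k::field \<Rightarrow> ('a \<Rightarrow> 'k) \<Rightarrow> 'a \<Rightarrow> 'k" where
  "fscale c v = (\<lambda>x. c * v x)"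

lemma fscale_apply [simp]: "fscale c v x = c * v x"
  by (simp add: fscale_def)

lemma sum_fun_apply: "(\<Sum>i\<in>I. f i) x = (\<Sum>i\<in>I. f i x)" for f :: "'i \<Rightarrow> 'a \<Rightarrow> 'k::comm_monoid_add"
  by (induction I rule: infinite_finite_induct) auto

lemma vector_space_fscale: "vector_space (fscale :: 'k::field \<Rightarrow> ('a \<Rightarrow> 'k) \<Rightarrow> _)"
  by standard (auto simp: algebra_simps)

lemma linear_fscale_iff:
  "Vector_Spaces.linear fscale fscale f \<longleftrightarrow>
    (\<forall>x y. f (x + y) = f x + f y) \<and> (\<forall>c x. f (fscale c x) = fscale c (f x))"
  by (simp add: Vector_Spaces.linear_iff vector_space_fscale)

type_synonym 'k pvec = "nat set \<times> nat set \<Rightarrow> 'k"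

section \<open>Signs of shuffles, and the operators twisted by them\<close>

lemma wsign_square: "wsign S T * wsign S T = (1 :: 'k::field)"
  by (simp add: wsign_def power_mult_distrib[symmetric])

lemma finite_inversions: "finite S \<Longrightarrow> finite T \<Longrightarrow> finite {(s,t). s \<in> S \<and> t \<in> T \<and> t < (s::nat)}"
  by (rule finite_subset[of _ "S \<times> T"]) auto

lemma wsign_Un_left:
  assumes "finite A" "finite B" "finite C" "A \<inter> B = {}"
  shows "wsign (A \<union> B) C = (wsign A C * wsign B C :: 'k::field)"
proof -
  have "{(s,t). s \<in> A \<union> B \<and> t \<in> C \<and> t < s} =
    {(s,t). s \<in> A \<and> t \<in> C \<and> t < s} \<union> {(s,t). s \<in> B \<and> t \<in> C \<and> t < s}" by auto
  then have "card {(s,t). s \<in> A \<union> B \<and> t \<in> C \<and> t < s} =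
    card {(s,t). s \<in> A \<and> t \<in> C \<and> t < s} + card {(s,t). s \<in> B \<and> t \<in> C \<and> t < s}"
    using assms by (simp, intro card_Un_disjoint finite_inversions) auto
  then show ?thesis by (simp only: wsign_def power_add)
qed

lemma wsign_Un_right:
  assumes "finite A" "finite B" "finite C" "B \<inter> C = {}"
  shows "wsign A (B \<union> C) = (wsign A B * wsign A C :: 'k::field)"
proof -
  have "{(s,t). s \<in> A \<and> t \<in> B \<union> C \<and> t < s} =
    {(s,t). s \<in> A \<and> t \<in> B \<and> t < s} \<union> {(s,t). s \<in> A \<and> t \<in> C \<and> t < s}" by auto
  then have "card {(s,t). s \<in> A \<and> t \<in> B \<union> C \<and> t < s} =
    card {(s,t). s \<in> A \<and> t \<in> B \<and> t < s} + card {(s,t). s \<in> A \<and> t \<in> C \<and> t < s}"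
    using assms by (simp, intro card_Un_disjoint finite_inversions) auto
  then show ?thesis by (simp only: wsign_def power_add)
qed

text \<open>Both factors on the left contain \<open>wsign (S - R) T\<close>, whose square is 1. What
  remains is the sign occurring in \<open>theta_basis\<close> and, up to renaming, in
  \<open>delta_basis\<close>.\<close>

lemma wsign_move:
  assumes "finite S" "finite T" "R \<subseteq> S" "R \<inter> T = {}"
  shows "wsign S T * wsign (S - R) (T \<union> R) = (wsign (S - R) R * wsign R T :: 'k::field)"
proof -
  have R: "finite R" "S = (S - R) \<union> R" using assms finite_subset by auto
  have "wsign S T = (wsign (S - R) T * wsign R T :: 'k)"
    using wsign_Un_left[of "S - R" R T] R assms by auto
  moreover have "wsign (S - R) (T \<union> R) = (wsign (S - R) T * wsign (S - R) R :: 'k)"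
    using wsign_Un_right[of "S - R" T R] R assms by auto
  moreover have "wsign (S - R) T * wsign R T * (wsign (S - R) T * wsign (S - R) R)
     = (wsign (S - R) T * wsign (S - R) T) * (wsign (S - R) R * wsign R T :: 'k)"
    by (simp only: ac_simps)
  ultimately show ?thesis by (simp add: wsign_square)
qed

text \<open>Written on coefficients: the arguments of \<open>v\<close> are the pairs from which
  \<open>(S,T)\<close> arises when \<open>r\<close> moves from the second set to the first.
  \<open>lower\<close> is the mirror image.\<close>

definition raise :: "'k::field pvec \<Rightarrow> 'k pvec" where
  "raise v = (\<lambda>(S,T). \<Sum>r\<in>S - T. v (S - {r}, insert r T))"

definition lower :: "'k::field pvec \<Rightarrow> 'k pvec" where
  "lower v = (\<lambda>(S,T). \<Sum>r\<in>T - S. v (insert r S, T - {r}))"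

text \<open>The sign reorders \<open>e\<^sub>S \<otimes> e\<^sub>T\<close> so that the two copies of each basis vector become adjacent; after
  twisting by it, \<open>delta_map\<close> and \<open>theta_map\<close> move elements between the two factors without signs.\<close>

definition twist :: "'k::field pvec \<Rightarrow> 'k pvec" where
  "twist v = (\<lambda>(S,T). wsign S T * v (S,T))"

definition ext_E :: "'k::field pvec \<Rightarrow> 'k pvec" where
  "ext_E v = twist (raise (twist v))"

definition ext_F :: "'k::field pvec \<Rightarrow> 'k pvec" where
  "ext_F v = twist (lower (twist v))"

lemma twist_twist [simp]: "twist (twist v) = v"
  by (auto simp: twist_def wsign_square mult.assoc[symmetric])

lemma ext_E_funpow: "(ext_E ^^ t) v = twist ((raise ^^ t) (twist v))"
  by (induction t) (simp_all add: ext_E_def)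

lemma ext_F_funpow: "(ext_F ^^ t) v = twist ((lower ^^ t) (twist v))"
  by (induction t) (simp_all add: ext_F_def)

lemma linear_ext_E: "Vector_Spaces.linear fscale fscale (ext_E :: 'k::field pvec \<Rightarrow> _)"
  unfolding linear_fscale_iff
  by (auto simp: ext_E_def raise_def twist_def fun_eq_iff algebra_simps sum.distrib sum_distrib_left)

lemma linear_ext_F: "Vector_Spaces.linear fscale fscale (ext_F :: 'k::field pvec \<Rightarrow> _)"
  unfolding linear_fscale_iff
  by (auto simp: ext_F_def lower_def twist_def fun_eq_iff algebra_simps sum.distrib sum_distrib_left)

lemma raise_apply: "raise v (S,T) = (\<Sum>r\<in>S - T. v (S - {r}, insert r T))"
  by (simp add: raise_def)

text \<open>Moving two distinct elements in opposite directions gives the same terms in either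
  order. Returning the element just moved gives \<open>card (S - T)\<close> copies of
  \<open>v (S,T)\<close> in one order and \<open>card (T - S)\<close> in the other, with difference
  \<open>card S - card T\<close>.\<close>

lemma raise_lower_comm:
  fixes v :: "'k::field pvec"
  assumes S: "finite S" and T: "finite T"
  shows "raise (lower v) (S,T) = lower (raise v) (S,T) + (of_nat (card S) - of_nat (card T)) * v (S,T)"
proof -
  let ?m = "\<lambda>r s. v (insert s (S - {r}), insert r T - {s})"
  have "raise (lower v) (S,T) = (\<Sum>r\<in>S - T. \<Sum>s\<in>insert r T - (S - {r}). ?m r s)"
    by (simp add: raise_def lower_def)
  also have "\<dots> = (\<Sum>r\<in>S - T. v (S,T) + (\<Sum>s\<in>T - S. ?m r s))"
  proof (rule sum.cong[OF refl])
    fix r assume r: "r \<in> S - T"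
    then have "insert r T - (S - {r}) = insert r (T - S)" by auto
    moreover have "insert r (S - {r}) = S" "insert r T - {r} = T" using r by auto
    ultimately show "(\<Sum>s\<in>insert r T - (S - {r}). ?m r s) = v (S,T) + (\<Sum>s\<in>T - S. ?m r s)"
      using r T by simp
  qed
  finally have 1: "raise (lower v) (S,T) =
      of_nat (card (S - T)) * v (S,T) + (\<Sum>r\<in>S - T. \<Sum>s\<in>T - S. ?m r s)"
    by (simp add: sum.distrib)
  have "lower (raise v) (S,T) = (\<Sum>s\<in>T - S. \<Sum>r\<in>insert s S - (T - {s}). v (insert s S - {r}, insert r (T - {s})))"
    by (simp add: raise_def lower_def)
  also have "\<dots> = (\<Sum>s\<in>T - S. v (S,T) + (\<Sum>r\<in>S - T. ?m r s))"
  proof (rule sum.cong[OF refl])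
    fix s assume s: "s \<in> T - S"
    then have "insert s S - (T - {s}) = insert s (S - T)" by auto
    moreover have "insert s (T - {s}) = T" "insert s S - {s} = S" using s by auto
    moreover have "(\<Sum>r\<in>S - T. v (insert s S - {r}, insert r (T - {s}))) = (\<Sum>r\<in>S - T. ?m r s)"
    proof (rule sum.cong[OF refl])
      fix r assume "r \<in> S - T"
      then have "insert s S - {r} = insert s (S - {r})" "insert r (T - {s}) = insert r T - {s}"
        using s by auto
      then show "v (insert s S - {r}, insert r (T - {s})) = ?m r s" by simp
    qed
    ultimately show "(\<Sum>r\<in>insert s S - (T - {s}). v (insert s S - {r}, insert r (T - {s})))
        = v (S,T) + (\<Sum>r\<in>S - T. ?m r s)"
      using s S by simp
  qed
  also have "\<dots> = of_nat (card (T - S)) * v (S,T) + (\<Sum>s\<in>T - S. \<Sum>r\<in>S - T. ?m r s)"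
    by (simp add: sum.distrib)
  finally have 2: "lower (raise v) (S,T) =
      of_nat (card (T - S)) * v (S,T) + (\<Sum>r\<in>S - T. \<Sum>s\<in>T - S. ?m r s)"
    by (subst sum.swap) simp
  have "card S = card (S - T) + card (S \<inter> T)" "card T = card (T - S) + card (S \<inter> T)"
    using card_Diff_subset_Int[of S T] card_Diff_subset_Int[of T S] S T
      card_mono[of S "S \<inter> T"] card_mono[of T "S \<inter> T"] by (simp_all add: Int_commute)
  then have "(of_nat (card S) - of_nat (card T) :: 'k) = of_nat (card (S - T)) - of_nat (card (T - S))"
    by simp
  then show ?thesis unfolding 1 2 by (simp only: left_diff_distrib) simp
qed

text \<open>Moving \<open>t\<close> elements one by one reaches each \<open>t\<close>-subset in
  \<open>t!\<close> orders, which is why \<open>\<delta>\<^sub>t\<close> is a divided power. In the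
  induction step every set of size \<open>Suc t\<close> is counted once for each choice of its
  element \<open>r\<close>.\<close>

lemma raise_funpow:
  fixes v :: "'k::field_char_0 pvec"
  assumes "finite S"
  shows "(raise ^^ t) v (S,T) = fact t * (\<Sum>R | R \<subseteq> S - T \<and> card R = t. v (S - R, T \<union> R))"
  using assms
proof (induction t arbitrary: S T)
  case 0
  then have "{R. R \<subseteq> S - T \<and> card R = 0} = {{}}" by (auto dest: finite_subset[OF _ finite_Diff])
  then show ?case by simp
next
  case (Suc t)
  let ?P = "\<lambda>U m. {R. R \<subseteq> U \<and> card R = m}"
  have finR: "finite R" if "R \<subseteq> S - T" for R using that Suc.prems finite_subset by blast
  have "(raise ^^ Suc t) v (S,T) =
      (\<Sum>r\<in>S - T. fact t * (\<Sum>R\<in>?P (S - {r} - insert r T) t. v (S - {r} - R, insert r T \<union> R)))"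
    using Suc by (simp add: raise_apply)
  also have "\<dots> = fact t * (\<Sum>(r,R)\<in>(SIGMA r:S - T. ?P (S - {r} - insert r T) t). v (S - {r} - R, insert r T \<union> R))"
    unfolding sum_distrib_left[symmetric] by (subst sum.Sigma) (use Suc.prems in auto)
  also have "(\<Sum>(r,R)\<in>(SIGMA r:S - T. ?P (S - {r} - insert r T) t). v (S - {r} - R, insert r T \<union> R))
      = (\<Sum>(R,r)\<in>(SIGMA R:?P (S - T) (Suc t). R). v (S - R, T \<union> R))"
  proof (rule sum.reindex_bij_witness[where i = "\<lambda>(R,r). (r, R - {r})" and j = "\<lambda>(r,R). (insert r R, r)"], goal_cases)
    case (2 x)
    then obtain r R where x: "x = (r, R)" "r \<in> S - T" "R \<subseteq> S - {r} - insert r T" "card R = t" by auto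
    have "finite R" using x finR by blast
    moreover have "r \<notin> R" using x by auto
    ultimately show ?case using x by auto
  next
    case (4 x)
    then obtain R r where x: "x = (R, r)" "r \<in> R" "R \<subseteq> S - T" "card R = Suc t" by auto
    have "finite R" using x finR by blast
    then show ?case using x by auto
  next
    case (5 x)
    then obtain r R where x: "x = (r, R)" "r \<in> S - T" "R \<subseteq> S - {r} - insert r T" "card R = t" by auto
    have "S - insert r R = S - {r} - R" by auto
    then show ?case using x by simp
  qed auto
  also have "\<dots> = (\<Sum>R\<in>?P (S - T) (Suc t). \<Sum>r\<in>R. v (S - R, T \<union> R))"
    by (rule sum.Sigma[symmetric]) (use Suc.prems finR in auto)
  also have "\<dots> = of_nat (Suc t) * (\<Sum>R\<in>?P (S - T) (Suc t). v (S - R, T \<union> R))"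
    unfolding sum_distrib_left by (rule sum.cong) auto
  finally show ?case by (simp only: fact_Suc of_nat_mult ac_simps)
qed

text \<open>Exchanging the two tensor factors reduces the counting for \<open>lower\<close> to that
  for \<open>raise\<close>.\<close>

lemma lower_swap: "lower v = raise (v \<circ> prod.swap) \<circ> prod.swap"
  by (auto simp: lower_def raise_def fun_eq_iff)

lemma lower_funpow_swap: "(lower ^^ t) v = (raise ^^ t) (v \<circ> prod.swap) \<circ> prod.swap"
proof (induction t)
  case (Suc t)
  have "(lower ^^ Suc t) v = lower ((lower ^^ t) v)" by simp
  also have "\<dots> = lower ((raise ^^ t) (v \<circ> prod.swap) \<circ> prod.swap)" unfolding Suc ..
  also have "\<dots> = raise ((raise ^^ t) (v \<circ> prod.swap) \<circ> prod.swap \<circ> prod.swap) \<circ> prod.swap"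
    by (rule lower_swap)
  finally show ?case by (simp add: comp_def)
qed (simp add: comp_assoc)

lemma lower_funpow:
  fixes v :: "'k::field_char_0 pvec"
  assumes "finite T"
  shows "(lower ^^ t) v (S,T) = fact t * (\<Sum>R | R \<subseteq> T - S \<and> card R = t. v (S \<union> R, T - R))"
  unfolding lower_funpow_swap using assms by (simp add: raise_funpow)

definition wspace :: "nat \<Rightarrow> nat \<Rightarrow> nat \<Rightarrow> 'k::field pvec set" where
  "wspace n N q = {v. \<forall>S T. v (S,T) \<noteq> 0 \<longrightarrow> S \<subseteq> {..<n} \<and> T \<subseteq> {..<n} \<and> card S + card T = N \<and> card T = q}"

lemma wspaceD:
  assumes "v \<in> wspace n N q" "v (S,T) \<noteq> 0"
  shows "S \<subseteq> {..<n}" "T \<subseteq> {..<n}" "card S + card T = N" "card T = q"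
  using assms unfolding wspace_def by blast+

lemma wspaceI:
  assumes "\<And>S T. v (S,T) \<noteq> 0 \<Longrightarrow> S \<subseteq> {..<n}" "\<And>S T. v (S,T) \<noteq> 0 \<Longrightarrow> T \<subseteq> {..<n}"
    "\<And>S T. v (S,T) \<noteq> 0 \<Longrightarrow> card S + card T = N" "\<And>S T. v (S,T) \<noteq> 0 \<Longrightarrow> card T = q"
  shows "v \<in> wspace n N q"
  using assms unfolding wspace_def by blast

lemma tens_space_eq_wspace: "tens_space n p q = wspace n (p + q) q"
proof -
  have "(S,T) \<in> tens_basis n p q \<longleftrightarrow>
      S \<subseteq> {..<n} \<and> T \<subseteq> {..<n} \<and> card S + card T = p + q \<and> card T = q" for S T
    unfolding tens_basis_def ext_basis_def mem_Times_iff by auto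
  then show ?thesis unfolding tens_space_def wspace_def by simp
qed

lemma twist_wspace: "v \<in> wspace n N q \<Longrightarrow> twist v \<in> wspace n N q"
  unfolding wspace_def twist_def by clarsimp

lemma raise_wspace_0: "v \<in> wspace n N 0 \<Longrightarrow> raise v = 0"
proof -
  assume v: "v \<in> wspace n N 0"
  have "v (S - {r}, insert r T) = 0" for S T r
  proof (rule ccontr)
    assume "v (S - {r}, insert r T) \<noteq> 0"
    with v have "insert r T \<subseteq> {..<n}" "card (insert r T) = 0" by (auto dest: wspaceD simp del: insert_subset)
    then show False using finite_subset[of "insert r T" "{..<n}"] by auto
  qed
  then show ?thesis by (auto simp: raise_def fun_eq_iff)
qed

lemma raise_wspace:
  assumes v: "v \<in> wspace n N (Suc q)"
  shows "raise v \<in> wspace n N q"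
  unfolding wspace_def
proof (intro CollectI allI impI)
  fix S T assume "raise v (S,T) \<noteq> 0"
  then obtain r where r: "r \<in> S - T" "v (S - {r}, insert r T) \<noteq> 0"
    unfolding raise_def by (auto elim: sum.not_neutral_contains_not_neutral)
  with v have *: "S - {r} \<subseteq> {..<n}" "insert r T \<subseteq> {..<n}"
    "card (S - {r}) + card (insert r T) = N" "card (insert r T) = Suc q" unfolding wspace_def by blast+
  then have "S \<subseteq> {..<n}" "T \<subseteq> {..<n}" using r by auto
  moreover from this have "finite S" "finite T" using finite_subset by auto
  moreover have "card S > 0" using r \<open>finite S\<close> by (auto simp: card_gt_0_iff)
  ultimately show "S \<subseteq> {..<n} \<and> T \<subseteq> {..<n} \<and> card S + card T = N \<and> card T = q"
    using * r by (auto simp: card_Diff_singleton)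
qed

lemma lower_wspace:
  assumes v: "v \<in> wspace n N q"
  shows "lower v \<in> wspace n N (Suc q)"
  unfolding wspace_def
proof (intro CollectI allI impI)
  fix S T assume "lower v (S,T) \<noteq> 0"
  then obtain r where r: "r \<in> T - S" "v (insert r S, T - {r}) \<noteq> 0"
    unfolding lower_def by (auto elim: sum.not_neutral_contains_not_neutral)
  with v have *: "insert r S \<subseteq> {..<n}" "T - {r} \<subseteq> {..<n}"
    "card (insert r S) + card (T - {r}) = N" "card (T - {r}) = q" unfolding wspace_def by blast+
  then have "S \<subseteq> {..<n}" "T \<subseteq> {..<n}" using r by auto
  moreover from this have "finite S" "finite T" using finite_subset by auto
  moreover have "card T > 0" using r \<open>finite T\<close> by (auto simp: card_gt_0_iff)
  ultimately show "S \<subseteq> {..<n} \<and> T \<subseteq> {..<n} \<and> card S + card T = N \<and> card T = Suc q"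
    using * r by (auto simp: card_Diff_singleton)
qed

lemma wspace_outside:
  "v \<in> wspace n N q \<Longrightarrow> \<not> (S \<subseteq> {..<n} \<and> T \<subseteq> {..<n}) \<Longrightarrow> v (S,T) = 0"
  using wspaceD by blast

text \<open>\<open>twist\<close> is an involution preserving every weight space, so all properties
  carry over from \<open>raise\<close> and \<open>lower\<close>; on degrees
  \<open>(N - q, q)\<close> the difference of the cardinalities is \<open>N - 2q\<close>.\<close>

lemma sl2_weights_ext: "sl2_weights fscale (ext_E :: 'k::field_char_0 pvec \<Rightarrow> _) ext_F (wspace n N) N"
proof (intro sl2_weights.intro sl2_weights_axioms.intro vector_space_fscale linear_ext_E linear_ext_F)
  interpret V: vector_space "fscale :: 'k \<Rightarrow> 'k pvec \<Rightarrow> _" by (rule vector_space_fscale)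
  fix q and v :: "'k pvec"
  show "V.subspace (wspace n N q :: 'k pvec set)"
  proof (rule V.subspaceI)
    fix x y :: "'k pvec" and c
    assume x: "x \<in> wspace n N q"
    have "x (S,T) \<noteq> 0" if "fscale c x (S,T) \<noteq> 0" for S T using that by simp
    then show "fscale c x \<in> wspace n N q" using wspaceD[OF x] by (intro wspaceI) blast+
    assume y: "y \<in> wspace n N q"
    have "x (S,T) \<noteq> 0 \<or> y (S,T) \<noteq> 0" if "(x + y) (S,T) \<noteq> 0" for S T using that by auto
    then show "x + y \<in> wspace n N q" using wspaceD[OF x] wspaceD[OF y] by (intro wspaceI) blast+
  qed (simp add: wspace_def)
  show "ext_E v = 0" if "v \<in> wspace n N 0"
    using raise_wspace_0[OF twist_wspace[OF that]] by (auto simp: ext_E_def twist_def fun_eq_iff)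
  show E: "ext_E v \<in> wspace n N q" if "v \<in> wspace n N (Suc q)" for q v
    unfolding ext_E_def by (intro twist_wspace raise_wspace that)
  show F: "ext_F v \<in> wspace n N (Suc q)" if "v \<in> wspace n N q" for q v
    unfolding ext_F_def by (intro twist_wspace lower_wspace that)
  assume v: "v \<in> wspace n N q"
  define w where "w = twist v"
  have w: "w \<in> wspace n N q" unfolding w_def by (rule twist_wspace[OF v])
  have "raise (lower w) (S,T) = lower (raise w) (S,T) + (of_nat N - 2 * of_nat q) * w (S,T)" for S T
  proof (cases "S \<subseteq> {..<n} \<and> T \<subseteq> {..<n}")
    case True
    then have "finite S" "finite T" using finite_subset by auto
    moreover have "(of_nat (card S) - of_nat (card T)) * w (S,T) = (of_nat N - 2 * of_nat q) * w (S,T)"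
    proof (cases "w (S,T) = 0")
      case False
      with w have "card S + card T = N" "card T = q" unfolding wspace_def by blast+
      then have "N = card S + q" "card T = q" by auto
      then show ?thesis by simp
    qed simp
    ultimately show ?thesis by (simp add: raise_lower_comm)
  next
    case False
    have "lower (raise w) (S,T) = 0"
    proof (cases q)
      case 0
      then have "raise w = 0" using raise_wspace_0 w by blast
      then show ?thesis by (simp add: lower_def)
    next
      case (Suc p)
      then show ?thesis using wspace_outside[OF lower_wspace[OF raise_wspace] False] w by simp
    qed
    then show ?thesis
      using wspace_outside[OF raise_wspace[OF lower_wspace[OF w]] False] wspace_outside[OF w False] by simp
  qed
  moreover have "v (S,T) = wsign S T * w (S,T)" for S T
    by (simp add: w_def twist_def mult.assoc[symmetric] wsign_square)
  ultimately show "ext_E (ext_F v) = ext_F (ext_E v) + fscale (of_nat N - 2 * of_nat q) v"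
    unfolding ext_E_def ext_F_def twist_twist w_def[symmetric]
    by (auto simp: fun_eq_iff twist_def[of "raise _"] twist_def[of "lower _"] distrib_left mult.left_commute)
qed

text \<open>For a given target and a given moved set \<open>R\<close> the source is determined and
  \<open>wsign_move\<close> gives the sign. After exchanging the two sums, the sum over
  \<open>R\<close> is the one in \<open>raise_funpow\<close> between two twists.\<close>

lemma delta_map_eq:
  fixes v :: "'k::field_char_0 pvec"
  assumes v: "v \<in> tens_space n p q"
  shows "delta_map n p q t v = fscale (inverse (fact t)) ((ext_E ^^ t) v)"
proof (rule ext, clarify)
  fix S' T'
  let ?B = "tens_basis n p q"
  let ?Q = "{R. R \<subseteq> {..<n} \<and> card R = t}"
  have finB: "finite ?B" by (simp add: tens_basis_def ext_basis_def)
  define c where "c R = (if R \<subseteq> S' - T' then wsign S' T' * wsign (S' - R) (T' \<union> R) else (0::'k))" for R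
  have "delta_map n p q t v (S',T') = (\<Sum>x\<in>?B. \<Sum>R\<in>?Q. if x = (S' - R, T' \<union> R) then v x * c R else 0)"
    unfolding delta_map_def lin_ext_def
  proof (rule sum.cong[OF refl])
    fix x assume x: "x \<in> ?B"
    obtain S T where xST: "x = (S,T)" by force
    have ST: "S \<subseteq> {..<n}" "T \<subseteq> {..<n}" using x xST by (auto simp: tens_basis_def ext_basis_def)
    have fin: "finite S" "finite T" using ST finite_subset by auto
    have "delta_basis t x (S',T') = (\<Sum>R\<in>{R. R \<subseteq> T \<and> card R = t}.
       if S \<inter> R = {} \<and> S' = S \<union> R \<and> T' = T - R then wsign R (T - R) * wsign S R else (0::'k))"
      by (simp add: delta_basis_def xST)
    also have "\<dots> = (\<Sum>R\<in>{R. R \<subseteq> T \<and> card R = t}. if x = (S' - R, T' \<union> R) then c R else 0)"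
    proof (rule sum.cong[OF refl])
      fix R assume "R \<in> {R. R \<subseteq> T \<and> card R = t}"
      then have R: "R \<subseteq> T" by simp
      show "(if S \<inter> R = {} \<and> S' = S \<union> R \<and> T' = T - R then wsign R (T - R) * wsign S R else 0)
        = (if x = (S' - R, T' \<union> R) then c R else 0)"
      proof (cases "S \<inter> R = {} \<and> S' = S \<union> R \<and> T' = T - R")
        case True
        then have "x = (S' - R, T' \<union> R)" using R xST by auto
        moreover have "R \<subseteq> S' - T'" using True by auto
        moreover have "S' - R = S" using True by auto
        moreover have "wsign S' T' * wsign (S' - R) (T' \<union> R) = (wsign (S' - R) R * wsign R T' :: 'k)"
          by (rule wsign_move) (use True fin R finite_subset in auto)
        ultimately show ?thesis using True by (simp add: c_def mult.commute)
      next
        case False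
        have "c R = 0" if "x = (S' - R, T' \<union> R)" using False that xST by (auto simp: c_def)
        then show ?thesis using False by auto
      qed
    qed
    also have "\<dots> = (\<Sum>R\<in>?Q. if x = (S' - R, T' \<union> R) then c R else 0)"
      by (rule sum.mono_neutral_left) (use ST xST in auto)
    finally show "v x * delta_basis t x (S',T') = (\<Sum>R\<in>?Q. if x = (S' - R, T' \<union> R) then v x * c R else 0)"
      by (simp add: sum_distrib_left if_distrib cong: if_cong)
  qed
  also have "\<dots> = (\<Sum>R\<in>?Q. \<Sum>x\<in>?B. if x = (S' - R, T' \<union> R) then v x * c R else 0)"
    by (rule sum.swap)
  also have "\<dots> = (\<Sum>R\<in>?Q. v (S' - R, T' \<union> R) * c R)"
    by (rule sum.cong) (use finB v in \<open>auto simp: tens_space_def\<close>)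
  finally have lhs: "delta_map n p q t v (S',T') = (\<Sum>R\<in>?Q. v (S' - R, T' \<union> R) * c R)" .
  show "delta_map n p q t v (S',T') = fscale (inverse (fact t)) ((ext_E ^^ t) v) (S',T')"
  proof (cases "S' \<subseteq> {..<n} \<and> T' \<subseteq> {..<n}")
    case True
    then have "finite S'" using finite_subset by auto
    then have "fscale (inverse (fact t)) ((ext_E ^^ t) v) (S',T')
        = (\<Sum>R | R \<subseteq> S' - T' \<and> card R = t. v (S' - R, T' \<union> R) * c R)"
      unfolding ext_E_funpow fscale_apply
      by (auto simp: twist_def raise_funpow c_def sum_distrib_left ac_simps intro!: sum.cong)
    also have "\<dots> = (\<Sum>R\<in>?Q. v (S' - R, T' \<union> R) * c R)"
      by (rule sum.mono_neutral_left) (use True in \<open>auto simp: c_def\<close>)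
    finally show ?thesis using lhs by simp
  next
    case False
    have "v (S' - R, T' \<union> R) = 0" if "R \<subseteq> {..<n}" for R
      using v wspace_outside[of v n "p + q" q "S' - R" "T' \<union> R"] False that
      unfolding tens_space_eq_wspace by blast
    then have "delta_map n p q t v (S',T') = 0" unfolding lhs by (auto intro: sum.neutral)
    moreover have "(ext_E ^^ t) v (S',T') = 0"
    proof -
      interpret sl2_weights fscale ext_E ext_F "wspace n (p + q)" "p + q" by (rule sl2_weights_ext)
      have v': "v \<in> wspace n (p + q) q" using v by (simp add: tens_space_eq_wspace)
      show ?thesis
      proof (cases "t \<le> q")
        case True
        then have "(ext_E ^^ t) v \<in> wspace n (p + q) (q - t)" using v' by (intro Epow_X) simp
        then show ?thesis using wspace_outside False by blast
      next
        case False
        then show ?thesis using Epow_X0[OF v', of t] by simp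
      qed
    qed
    ultimately show ?thesis by simp
  qed
qed

text \<open>The argument for \<open>delta_map_eq\<close> with the two factors exchanged:
  \<open>R\<close> now leaves the first set.\<close>

lemma theta_map_eq:
  fixes v :: "'k::field_char_0 pvec"
  assumes v: "v \<in> tens_space n p q"
  shows "theta_map n p q t v = fscale (inverse (fact t)) ((ext_F ^^ t) v)"
proof (rule ext, clarify)
  fix S' T'
  let ?B = "tens_basis n p q"
  let ?Q = "{R. R \<subseteq> {..<n} \<and> card R = t}"
  have finB: "finite ?B" by (simp add: tens_basis_def ext_basis_def)
  define c where "c R = (if R \<subseteq> T' - S' then wsign S' T' * wsign (S' \<union> R) (T' - R) else (0::'k))" for R
  have "theta_map n p q t v (S',T') = (\<Sum>x\<in>?B. \<Sum>R\<in>?Q. if x = (S' \<union> R, T' - R) then v x * c R else 0)"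
    unfolding theta_map_def lin_ext_def
  proof (rule sum.cong[OF refl])
    fix x assume x: "x \<in> ?B"
    obtain S T where xST: "x = (S,T)" by force
    have ST: "S \<subseteq> {..<n}" "T \<subseteq> {..<n}" using x xST by (auto simp: tens_basis_def ext_basis_def)
    have fin: "finite S" "finite T" using ST finite_subset by auto
    have "theta_basis t x (S',T') = (\<Sum>R\<in>{R. R \<subseteq> S \<and> card R = t}.
       if R \<inter> T = {} \<and> S' = S - R \<and> T' = R \<union> T then wsign (S - R) R * wsign R T else (0::'k))"
      by (simp add: theta_basis_def xST)
    also have "\<dots> = (\<Sum>R\<in>{R. R \<subseteq> S \<and> card R = t}. if x = (S' \<union> R, T' - R) then c R else 0)"
    proof (rule sum.cong[OF refl])
      fix R assume "R \<in> {R. R \<subseteq> S \<and> card R = t}"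
      then have R: "R \<subseteq> S" by simp
      show "(if R \<inter> T = {} \<and> S' = S - R \<and> T' = R \<union> T then wsign (S - R) R * wsign R T else 0)
        = (if x = (S' \<union> R, T' - R) then c R else 0)"
      proof (cases "R \<inter> T = {} \<and> S' = S - R \<and> T' = R \<union> T")
        case True
        then have "x = (S' \<union> R, T' - R)" using R xST by auto
        moreover have "R \<subseteq> T' - S'" using True by auto
        moreover have "S' \<union> R = S" "T' - R = T" using True R by auto
        moreover have "wsign S T * wsign (S - R) (T \<union> R) = (wsign (S - R) R * wsign R T :: 'k)"
          by (rule wsign_move) (use True fin R in auto)
        ultimately show ?thesis using True by (simp add: c_def ac_simps Un_commute)
      next
        case False
        have "c R = 0" if "x = (S' \<union> R, T' - R)" using False that xST by (auto simp: c_def)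
        then show ?thesis using False by auto
      qed
    qed
    also have "\<dots> = (\<Sum>R\<in>?Q. if x = (S' \<union> R, T' - R) then c R else 0)"
      by (rule sum.mono_neutral_left) (use ST xST in auto)
    finally show "v x * theta_basis t x (S',T') = (\<Sum>R\<in>?Q. if x = (S' \<union> R, T' - R) then v x * c R else 0)"
      by (simp add: sum_distrib_left if_distrib cong: if_cong)
  qed
  also have "\<dots> = (\<Sum>R\<in>?Q. \<Sum>x\<in>?B. if x = (S' \<union> R, T' - R) then v x * c R else 0)"
    by (rule sum.swap)
  also have "\<dots> = (\<Sum>R\<in>?Q. v (S' \<union> R, T' - R) * c R)"
    by (rule sum.cong) (use finB v in \<open>auto simp: tens_space_def\<close>)
  finally have lhs: "theta_map n p q t v (S',T') = (\<Sum>R\<in>?Q. v (S' \<union> R, T' - R) * c R)" .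
  show "theta_map n p q t v (S',T') = fscale (inverse (fact t)) ((ext_F ^^ t) v) (S',T')"
  proof (cases "S' \<subseteq> {..<n} \<and> T' \<subseteq> {..<n}")
    case True
    then have "finite T'" using finite_subset by auto
    then have "fscale (inverse (fact t)) ((ext_F ^^ t) v) (S',T')
        = (\<Sum>R | R \<subseteq> T' - S' \<and> card R = t. v (S' \<union> R, T' - R) * c R)"
      unfolding ext_F_funpow fscale_apply
      by (auto simp: twist_def lower_funpow c_def sum_distrib_left ac_simps intro!: sum.cong)
    also have "\<dots> = (\<Sum>R\<in>?Q. v (S' \<union> R, T' - R) * c R)"
      by (rule sum.mono_neutral_left) (use True in \<open>auto simp: c_def\<close>)
    finally show ?thesis using lhs by simp
  next
    case False
    have "v (S' \<union> R, T' - R) = 0" if "R \<subseteq> {..<n}" for R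
      using v wspace_outside[of v n "p + q" q "S' \<union> R" "T' - R"] False that
      unfolding tens_space_eq_wspace by blast
    then have "theta_map n p q t v (S',T') = 0" unfolding lhs by (auto intro: sum.neutral)
    moreover have "(ext_F ^^ t) v (S',T') = 0"
    proof -
      interpret sl2_weights fscale ext_E ext_F "wspace n (p + q)" "p + q" by (rule sl2_weights_ext)
      have "(ext_F ^^ t) v \<in> wspace n (p + q) (q + t)" using v by (intro Fpow_X) (simp add: tens_space_eq_wspace)
      then show ?thesis using wspace_outside False by blast
    qed
    ultimately show ?thesis by simp
  qed
qed

section \<open>Minors and equivariance\<close>

text \<open>For \<open>s\<close> in \<open>A\<close> this is the position of \<open>s\<close> in the
  increasing enumeration of \<open>A\<close>, so it inverts \<open>pick A\<close>; it indexes the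
  rows and columns of submatrices.\<close>

abbreviation below :: "nat set \<Rightarrow> nat \<Rightarrow> nat" where
  "below A s \<equiv> card {x \<in> A. x < s}"

abbreviation above :: "nat set \<Rightarrow> nat \<Rightarrow> nat" where
  "above A s \<equiv> card {x \<in> A. s < x}"

lemma below_above:
  assumes "finite A"
  shows "below A s + above A s = card (A - {s})"
proof -
  have "A - {s} = {x \<in> A. x < s} \<union> {x \<in> A. s < x}" by auto
  then show ?thesis using assms by (simp add: card_Un_disjoint disjoint_iff)
qed

lemma below_less: "finite A \<Longrightarrow> s \<in> A \<Longrightarrow> below A s < card A"
  by (intro psubset_card_mono) auto

lemma pick_below: "s \<in> A \<Longrightarrow> pick A (below A s) = s"
  by (rule pick_card_in_set)

lemma bij_betw_below: "finite A \<Longrightarrow> bij_betw (below A) A {..<card A}"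
  by (rule bij_betwI[where g = "pick A"]) (auto simp: below_less pick_below pick_in_set_le card_pick_le)

text \<open>Positions from that of \<open>s\<close> on shift by one, which is the reindexing built
  into \<open>mat_delete\<close>.\<close>

lemma pick_delete:
  assumes A: "finite A" "s \<in> A" and k: "k < card A - 1"
  shows "pick (A - {s}) k = pick A (if k < below A s then k else Suc k)"
proof -
  let ?m = "if k < below A s then k else Suc k"
  let ?y = "pick A ?m"
  have m: "?m < card A" using k by auto
  have y: "?y \<in> A" "below A ?y = ?m" using m by (simp_all add: pick_in_set_le card_pick_le)
  have "?y \<noteq> s" using y(2) by (auto split: if_splits)
  have "below (A - {s}) ?y = k"
  proof (cases "k < below A s")
    case True
    then have "?y < s"
      using pick_mono_le[of "below A s" A k] below_less[OF A] pick_below[OF A(2)] by simp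
    then have "{x \<in> A - {s}. x < ?y} = {x \<in> A. x < ?y}" by auto
    then show ?thesis using y(2) True by simp
  next
    case False
    then have "s < ?y"
      using pick_mono_le[of "Suc k" A "below A s"] m pick_below[OF A(2)] by simp
    then have "{x \<in> A - {s}. x < ?y} = {x \<in> A. x < ?y} - {s}" "s \<in> {x \<in> A. x < ?y}" using A by auto
    then show ?thesis using y(2) False A by simp
  qed
  then show ?thesis using pick_below[of ?y "A - {s}"] y(1) \<open>?y \<noteq> s\<close> by auto
qed

section \<open>Laplace expansion of minors\<close>

context
  fixes g :: "'k::field mat" and n :: nat
  assumes g: "g \<in> carrier_mat n n"
begin

lemma submatrix_carrier:
  assumes "A \<subseteq> {..<n}" "B \<subseteq> {..<n}"
  shows "submatrix g A B \<in> carrier_mat (card A) (card B)"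
proof -
  have "{i. i < n \<and> i \<in> A} = A" "{i. i < n \<and> i \<in> B} = B" using assms by auto
  then show ?thesis using g by (intro carrier_matI) (simp_all add: dim_submatrix)
qed

lemma submatrix_nth:
  assumes "A \<subseteq> {..<n}" "B \<subseteq> {..<n}" "i < card A" "j < card B"
  shows "submatrix g A B $$ (i, j) = g $$ (pick A i, pick B j)"
proof -
  have "{i. i < n \<and> i \<in> A} = A" "{i. i < n \<and> i \<in> B} = B" using assms by auto
  then show ?thesis using g assms by (intro submatrix_index) auto
qed

lemma mat_delete_submatrix:
  assumes A: "A \<subseteq> {..<n}" "s \<in> A" and B: "B \<subseteq> {..<n}" "r \<in> B"
  shows "mat_delete (submatrix g A B) (below A s) (below B r) = submatrix g (A - {s}) (B - {r})"
proof (rule eq_matI)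
  have fin: "finite A" "finite B" using A B finite_subset by auto
  have A': "A - {s} \<subseteq> {..<n}" "B - {r} \<subseteq> {..<n}" using A B by auto
  note C = carrier_matD[OF submatrix_carrier[OF A(1) B(1)]]
  have card: "card (A - {s}) = card A - 1" "card (B - {r}) = card B - 1" using fin A B by simp_all
  note C' = carrier_matD[OF submatrix_carrier[OF A'], unfolded card]
  show "dim_row (mat_delete (submatrix g A B) (below A s) (below B r)) = dim_row (submatrix g (A - {s}) (B - {r}))"
    "dim_col (mat_delete (submatrix g A B) (below A s) (below B r)) = dim_col (submatrix g (A - {s}) (B - {r}))"
    by (simp_all add: C C')
  fix i j assume "i < dim_row (submatrix g (A - {s}) (B - {r}))" "j < dim_col (submatrix g (A - {s}) (B - {r}))"
  then have ij: "i < card A - 1" "j < card B - 1" by (simp_all add: C')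
  let ?i = "if i < below A s then i else Suc i" and ?j = "if j < below B r then j else Suc j"
  have "mat_delete (submatrix g A B) (below A s) (below B r) $$ (i, j) = submatrix g A B $$ (?i, ?j)"
    using ij by (simp add: mat_delete_def C)
  also have "?i < card A" "?j < card B" using ij by auto
  then have "submatrix g A B $$ (?i, ?j) = g $$ (pick A ?i, pick B ?j)" by (rule submatrix_nth[OF A(1) B(1)])
  also have "\<dots> = g $$ (pick (A - {s}) i, pick (B - {r}) j)"
    unfolding pick_delete[OF fin(1) A(2) ij(1)] pick_delete[OF fin(2) B(2) ij(2)] ..
  also have "\<dots> = submatrix g (A - {s}) (B - {r}) $$ (i, j)"
    using ij by (intro submatrix_nth[symmetric] A') (simp_all add: card)
  finally show "mat_delete (submatrix g A B) (below A s) (below B r) $$ (i, j) = submatrix g (A - {s}) (B - {r}) $$ (i, j)" .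
qed

text \<open>Expansion along row \<open>s\<close> of the matrix with rows \<open>insert s C\<close>.
  If \<open>s\<close> already lies in \<open>C\<close>, the sum is the determinant of a matrix with
  a repeated row.\<close>

lemma minor_row_expansion:
  assumes C: "C \<subseteq> {..<n}" and B: "B \<subseteq> {..<n}" and card: "card B = Suc (card C)" and s: "s < n"
  shows "(\<Sum>r\<in>B. (-1) ^ below B r * g $$ (s, r) * det (submatrix g C (B - {r})))
    = (if s \<in> C then 0 else (-1) ^ below C s * det (submatrix g (insert s C) B))"
proof -
  let ?k = "card B"
  have fin: "finite B" "finite C" using B C finite_subset by auto
  note bij = bij_betw_below[OF fin(1)]
  show ?thesis
  proof (cases "s \<in> C")
    case True
    \<comment> \<open>A submatrix is indexed by sets and cannot repeat a row, so the matrix with row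
      \<open>s\<close> placed on top of the rows of \<open>C\<close> is built by hand.\<close>
    define M where "M = mat ?k ?k (\<lambda>(i,j). g $$ (if i = 0 then s else pick C (i - 1), pick B j))"
    have M: "M \<in> carrier_mat ?k ?k" by (simp add: M_def)
    have k: "Suc (below C s) < ?k" using below_less[OF fin(2) True] card by simp
    have "row M 0 = row M (Suc (below C s))"
      using k True by (intro eq_vecI) (auto simp: M_def pick_below)
    then have "det M = 0" using k by (intro det_identical_rows[OF M, of 0 "Suc (below C s)"]) auto
    moreover have "det M = (\<Sum>j<?k. M $$ (0, j) * cofactor M 0 j)"
      by (rule laplace_expansion_row[OF M]) (use card in simp)
    moreover have "\<dots> = (\<Sum>r\<in>B. M $$ (0, below B r) * cofactor M 0 (below B r))"
      using sum.reindex_bij_betw[OF bij, of "\<lambda>j. M $$ (0, j) * cofactor M 0 j"] by simp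
    moreover have "\<dots> = (\<Sum>r\<in>B. (-1) ^ below B r * g $$ (s, r) * det (submatrix g C (B - {r})))"
    proof (rule sum.cong[OF refl])
      fix r assume r: "r \<in> B"
      have B': "B - {r} \<subseteq> {..<n}" using B by auto
      have cB: "card (B - {r}) = card C" using fin r card by simp
      note C' = carrier_matD[OF submatrix_carrier[OF C B'], unfolded cB]
      have "mat_delete M 0 (below B r) = submatrix g C (B - {r})"
      proof (rule eq_matI)
        fix i j assume "i < dim_row (submatrix g C (B - {r}))" "j < dim_col (submatrix g C (B - {r}))"
        then have ij: "i < card C" "j < card C" by (simp_all add: C')
        let ?j = "if j < below B r then j else Suc j"
        have "mat_delete M 0 (below B r) $$ (i, j) = M $$ (Suc i, ?j)"
          using ij card by (simp add: mat_delete_def M_def)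
        also have "\<dots> = g $$ (pick C i, pick B ?j)" using ij card by (simp add: M_def)
        also have "pick B ?j = pick (B - {r}) j" using pick_delete[OF fin(1) r, of j] ij card by simp
        also have "g $$ (pick C i, pick (B - {r}) j) = submatrix g C (B - {r}) $$ (i, j)"
          using ij by (intro submatrix_nth[symmetric] C B') (simp_all add: cB)
        finally show "mat_delete M 0 (below B r) $$ (i, j) = submatrix g C (B - {r}) $$ (i, j)" .
      qed (simp_all add: M_def C' card)
      moreover have "M $$ (0, below B r) = g $$ (s, r)"
        using below_less[OF fin(1) r] k by (simp add: M_def pick_below[OF r])
      ultimately show "M $$ (0, below B r) * cofactor M 0 (below B r)
          = (-1) ^ below B r * g $$ (s, r) * det (submatrix g C (B - {r}))"
        by (simp add: cofactor_def)
    qed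
    ultimately show ?thesis using True by simp
  next
    case False
    let ?A = "insert s C"
    have A: "?A \<subseteq> {..<n}" using C s by auto
    have cA: "card ?A = ?k" using False fin card by simp
    have below: "below ?A s = below C s" by (rule arg_cong[where f = card]) auto
    have AC: "?A - {s} = C" using False by auto
    let ?M = "submatrix g ?A B"
    have M: "?M \<in> carrier_mat ?k ?k" using submatrix_carrier[OF A B] cA by simp
    have lt: "below C s < ?k" using below_less[of ?A s] fin cA below by simp
    have "det ?M = (\<Sum>j<?k. ?M $$ (below C s, j) * cofactor ?M (below C s) j)"
      by (rule laplace_expansion_row[OF M lt])
    also have "\<dots> = (\<Sum>r\<in>B. ?M $$ (below C s, below B r) * cofactor ?M (below C s) (below B r))"
      using sum.reindex_bij_betw[OF bij, of "\<lambda>j. ?M $$ (below C s, j) * cofactor ?M (below C s) j"] by simp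
    also have "\<dots> = (\<Sum>r\<in>B. (-1) ^ below C s * ((-1) ^ below B r * g $$ (s, r) * det (submatrix g C (B - {r}))))"
    proof (rule sum.cong[OF refl])
      fix r assume r: "r \<in> B"
      have "?M $$ (below C s, below B r) = g $$ (s, r)"
        using submatrix_nth[OF A B, of "below C s" "below B r"] lt cA below_less[OF fin(1) r]
          pick_below[of s ?A] pick_below[OF r] below by simp
      moreover have "mat_delete ?M (below C s) (below B r) = submatrix g C (B - {r})"
        using mat_delete_submatrix[OF A _ B r, of s] below AC by simp
      ultimately show "?M $$ (below C s, below B r) * cofactor ?M (below C s) (below B r)
         = (-1) ^ below C s * ((-1) ^ below B r * g $$ (s, r) * det (submatrix g C (B - {r})))"
        by (simp add: cofactor_def power_add ac_simps)
    qed
    finally have "(-1) ^ below C s * det ?M = (-1) ^ below C s * (-1) ^ below C s *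
        (\<Sum>r\<in>B. (-1) ^ below B r * g $$ (s, r) * det (submatrix g C (B - {r})))"
      by (simp add: sum_distrib_left mult.assoc)
    then show ?thesis using False by (simp add: power_mult_distrib[symmetric])
  qed
qed

lemma submatrix_transpose:
  assumes "A \<subseteq> {..<n}" "B \<subseteq> {..<n}"
  shows "submatrix (transpose_mat g) A B = transpose_mat (submatrix g B A)"
proof -
  have "{i. i < n \<and> i \<in> A} = A" "{i. i < n \<and> i \<in> B} = B" using assms by auto
  moreover have "pick A i < n" if "i < card A" for i using pick_in_set_le[OF that] assms by auto
  moreover have "pick B i < n" if "i < card B" for i using pick_in_set_le[OF that] assms by auto
  ultimately show ?thesis using g by (intro eq_matI) (auto simp: submatrix_def)
qed

lemma det_submatrix_transpose:
  assumes "A \<subseteq> {..<n}" "B \<subseteq> {..<n}" "card A = card B"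
  shows "det (submatrix (transpose_mat g) A B) = det (submatrix g B A)"
  using submatrix_transpose[OF assms(1,2)] submatrix_carrier[OF assms(2,1)] assms(3)
  by (simp add: det_transpose)

end

text \<open>The row expansion of the transposed matrix.\<close>

lemma minor_col_expansion:
  fixes g :: "'k::field mat"
  assumes g: "g \<in> carrier_mat n n"
    and A: "A \<subseteq> {..<n}" and B: "B \<subseteq> {..<n}" and card: "card A = Suc (card B)" and r: "r < n"
  shows "(\<Sum>s\<in>A. (-1) ^ below A s * g $$ (s, r) * det (submatrix g (A - {s}) B))
    = (if r \<in> B then 0 else (-1) ^ below B r * det (submatrix g A (insert r B)))"
proof -
  have fin: "finite A" "finite B" using A B finite_subset by auto
  have gT: "transpose_mat g \<in> carrier_mat n n" using g by simp
  have 1: "(\<Sum>s\<in>A. (-1) ^ below A s * transpose_mat g $$ (r, s) * det (submatrix (transpose_mat g) B (A - {s})))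
     = (\<Sum>s\<in>A. (-1) ^ below A s * g $$ (s, r) * det (submatrix g (A - {s}) B))"
  proof (rule sum.cong[OF refl])
    fix s assume s: "s \<in> A"
    then have "s < n" using A by auto
    moreover have "det (submatrix (transpose_mat g) B (A - {s})) = det (submatrix g (A - {s}) B)"
      by (rule det_submatrix_transpose[OF g]) (use A B card fin s in auto)
    ultimately show "(-1) ^ below A s * transpose_mat g $$ (r, s) * det (submatrix (transpose_mat g) B (A - {s}))
      = (-1) ^ below A s * g $$ (s, r) * det (submatrix g (A - {s}) B)"
      using g r by simp
  qed
  have 2: "det (submatrix (transpose_mat g) (insert r B) A) = det (submatrix g A (insert r B))" if "r \<notin> B"
    by (rule det_submatrix_transpose[OF g]) (use A B card fin r that in auto)
  show ?thesis using minor_row_expansion[OF gT B A card r] 1 2 by simp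
qed

text \<open>Counting positions from the other end changes the sign by a factor that is the same for
  all elements of \<open>A\<close>. Hence the expansions also hold with \<open>above\<close> in
  place of \<open>below\<close>.\<close>

lemma neg_one_power_above:
  assumes "finite A"
  shows "(-1) ^ above A s = ((-1) ^ card (A - {s}) * (-1) ^ below A s :: 'k::field)"
proof -
  have "(-1) ^ card (A - {s}) * (-1) ^ below A s = ((-1) ^ below A s * (-1) ^ below A s) * ((-1) ^ above A s :: 'k)"
    unfolding below_above[OF assms, of s, symmetric] power_add by (simp only: ac_simps)
  then show ?thesis by (simp add: power_mult_distrib[symmetric])
qed

lemma minor_row_expansion_above:
  fixes g :: "'k::field mat"
  assumes g: "g \<in> carrier_mat n n"
    and C: "C \<subseteq> {..<n}" and B: "B \<subseteq> {..<n}" and card: "card B = Suc (card C)" and s: "s < n"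
  shows "(\<Sum>r\<in>B. (-1) ^ above B r * g $$ (s, r) * det (submatrix g C (B - {r})))
    = (if s \<in> C then 0 else (-1) ^ above C s * det (submatrix g (insert s C) B))"
proof -
  have fin: "finite B" "finite C" using B C finite_subset by auto
  have "(\<Sum>r\<in>B. (-1) ^ above B r * g $$ (s, r) * det (submatrix g C (B - {r})))
    = (\<Sum>r\<in>B. (-1) ^ card C * ((-1) ^ below B r * g $$ (s, r) * det (submatrix g C (B - {r}))))"
    by (rule sum.cong) (use fin card in \<open>auto simp: neg_one_power_above\<close>)
  also have "\<dots> = (-1) ^ card C * (if s \<in> C then 0 else (-1) ^ below C s * det (submatrix g (insert s C) B))"
    unfolding sum_distrib_left[symmetric] minor_row_expansion[OF g C B card s] ..
  finally show ?thesis using fin by (simp add: neg_one_power_above)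
qed

lemma minor_col_expansion_above:
  fixes g :: "'k::field mat"
  assumes g: "g \<in> carrier_mat n n"
    and A: "A \<subseteq> {..<n}" and B: "B \<subseteq> {..<n}" and card: "card A = Suc (card B)" and r: "r < n"
  shows "(\<Sum>s\<in>A. (-1) ^ above A s * g $$ (s, r) * det (submatrix g (A - {s}) B))
    = (if r \<in> B then 0 else (-1) ^ above B r * det (submatrix g A (insert r B)))"
proof -
  have fin: "finite A" "finite B" using A B finite_subset by auto
  have "(\<Sum>s\<in>A. (-1) ^ above A s * g $$ (s, r) * det (submatrix g (A - {s}) B))
    = (\<Sum>s\<in>A. (-1) ^ card B * ((-1) ^ below A s * g $$ (s, r) * det (submatrix g (A - {s}) B)))"
    by (rule sum.cong) (use fin card in \<open>auto simp: neg_one_power_above\<close>)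
  also have "\<dots> = (-1) ^ card B * (if r \<in> B then 0 else (-1) ^ below B r * det (submatrix g A (insert r B)))"
    unfolding sum_distrib_left[symmetric] minor_col_expansion[OF g A B card r] ..
  finally show ?thesis using fin by (simp add: neg_one_power_above)
qed

text \<open>The common shape of \<open>ext_E\<close> and, after exchanging the factors,
  \<open>ext_F\<close> on weight spaces. The parameters say on which side of \<open>s\<close> the
  signs are counted, so that one equivariance proof covers both operators.\<close>

definition transfer :: "(nat set \<Rightarrow> nat \<Rightarrow> nat) \<Rightarrow> (nat set \<Rightarrow> nat \<Rightarrow> nat) \<Rightarrow> 'k::field pvec \<Rightarrow> 'k pvec" where
  "transfer \<alpha> \<beta> v = (\<lambda>(S,T). \<Sum>s\<in>S - T. (-1) ^ (\<alpha> S s + \<beta> T s) * v (S - {s}, insert s T))"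

text \<open>Both sides equal one double sum over \<open>s\<close> in \<open>A\<close> and
  \<open>r\<close> in \<open>D\<close>, with the entry \<open>g $$ (s, r)\<close> between two
  smaller minors. Summing over \<open>r\<close> first rebuilds the minor with columns
  \<open>D\<close> by row expansion; summing over \<open>s\<close> first rebuilds the one with rows
  \<open>A\<close> by column expansion.\<close>

lemma minor_exchange:
  fixes g :: "'k::field mat" and \<alpha> \<beta> :: "nat set \<Rightarrow> nat \<Rightarrow> nat"
  assumes g: "g \<in> carrier_mat n n" and \<alpha>\<beta>: "\<alpha> = below \<or> \<alpha> = above" "\<beta> = below \<or> \<beta> = above"
    and A: "A \<subseteq> {..<n}" and B: "B \<subseteq> {..<n}" and C: "C \<subseteq> {..<n}" and D: "D \<subseteq> {..<n}"
    and card: "card A = Suc (card B)" "card D = Suc (card C)"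
  shows "(\<Sum>s\<in>A - C. (-1) ^ (\<alpha> A s + \<beta> C s) * (det (submatrix g (A - {s}) B) * det (submatrix g (insert s C) D)))
    = (\<Sum>r\<in>D - B. (-1) ^ (\<alpha> B r + \<beta> D r) * (det (submatrix g A (insert r B)) * det (submatrix g C (D - {r}))))"
proof -
  have fin: "finite A" "finite D" using A D finite_subset by auto
  have row: "(\<Sum>r\<in>D. (-1) ^ \<beta> D r * g $$ (s, r) * det (submatrix g C (D - {r})))
    = (if s \<in> C then 0 else (-1) ^ \<beta> C s * det (submatrix g (insert s C) D))" if "s < n" for s
    using minor_row_expansion[OF g C D card(2) that] minor_row_expansion_above[OF g C D card(2) that] \<alpha>\<beta>(2)
    by (elim disjE) simp_all
  have col: "(\<Sum>s\<in>A. (-1) ^ \<alpha> A s * g $$ (s, r) * det (submatrix g (A - {s}) B))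
    = (if r \<in> B then 0 else (-1) ^ \<alpha> B r * det (submatrix g A (insert r B)))" if "r < n" for r
    using minor_col_expansion[OF g A B card(1) that] minor_col_expansion_above[OF g A B card(1) that] \<alpha>\<beta>(1)
    by (elim disjE) simp_all
  let ?t = "\<lambda>s r. (-1) ^ \<alpha> A s * (-1) ^ \<beta> D r * g $$ (s, r) * det (submatrix g (A - {s}) B) * det (submatrix g C (D - {r}))"
  have "(\<Sum>s\<in>A - C. (-1) ^ (\<alpha> A s + \<beta> C s) * (det (submatrix g (A - {s}) B) * det (submatrix g (insert s C) D)))
    = (\<Sum>s\<in>A. (-1) ^ \<alpha> A s * det (submatrix g (A - {s}) B) *
        (if s \<in> C then 0 else (-1) ^ \<beta> C s * det (submatrix g (insert s C) D)))"
    by (rule sum.mono_neutral_cong_left) (use fin in \<open>auto simp: power_add\<close>)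
  also have "\<dots> = (\<Sum>s\<in>A. \<Sum>r\<in>D. ?t s r)"
  proof (rule sum.cong[OF refl])
    fix s assume "s \<in> A"
    then have s: "s < n" using A by auto
    show "(-1) ^ \<alpha> A s * det (submatrix g (A - {s}) B) *
        (if s \<in> C then 0 else (-1) ^ \<beta> C s * det (submatrix g (insert s C) D)) = (\<Sum>r\<in>D. ?t s r)"
      unfolding row[OF s, symmetric] sum_distrib_left by (simp only: ac_simps)
  qed
  also have "\<dots> = (\<Sum>r\<in>D. \<Sum>s\<in>A. ?t s r)" by (rule sum.swap)
  also have "\<dots> = (\<Sum>r\<in>D. (-1) ^ \<beta> D r * det (submatrix g C (D - {r})) *
        (if r \<in> B then 0 else (-1) ^ \<alpha> B r * det (submatrix g A (insert r B))))"
  proof (rule sum.cong[OF refl])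
    fix r assume "r \<in> D"
    then have r: "r < n" using D by auto
    show "(\<Sum>s\<in>A. ?t s r) = (-1) ^ \<beta> D r * det (submatrix g C (D - {r})) *
        (if r \<in> B then 0 else (-1) ^ \<alpha> B r * det (submatrix g A (insert r B)))"
      unfolding col[OF r, symmetric] sum_distrib_left by (simp only: ac_simps)
  qed
  also have "\<dots> = (\<Sum>r\<in>D - B. (-1) ^ (\<alpha> B r + \<beta> D r) * (det (submatrix g A (insert r B)) * det (submatrix g C (D - {r}))))"
    by (rule sum.mono_neutral_cong_right) (use fin in \<open>auto simp: power_add\<close>)
  finally show ?thesis .
qed

text \<open>\<open>tens_act\<close> with the degrees read off from the target pair. A single
  operator then acts on all weight spaces, as is needed to state that it commutes with
  \<open>ext_E\<close> and \<open>ext_F\<close>.\<close>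

definition ext_act :: "nat \<Rightarrow> 'k::field mat \<Rightarrow> 'k pvec \<Rightarrow> 'k pvec" where
  "ext_act n g v = (\<lambda>(S',T'). if S' \<subseteq> {..<n} \<and> T' \<subseteq> {..<n} then
     (\<Sum>(S,T)\<in>tens_basis n (card S') (card T'). det (submatrix g S' S) * det (submatrix g T' T) * v (S,T)) else 0)"

lemma tens_act_eq_ext_act:
  assumes v: "v \<in> tens_space n p q"
  shows "tens_act n p q g v = ext_act n g v"
proof (rule ext, clarify)
  fix S' T'
  show "tens_act n p q g v (S',T') = ext_act n g v (S',T')"
  proof (cases "(S',T') \<in> tens_basis n p q")
    case True
    then show ?thesis by (auto simp: tens_act_def ext_act_def tens_basis_def ext_basis_def)
  next
    case False
    have "v (S,T) = 0" if "(S,T) \<in> tens_basis n (card S') (card T')" "S' \<subseteq> {..<n}" "T' \<subseteq> {..<n}" for S T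
    proof (rule ccontr)
      assume "v (S,T) \<noteq> 0"
      then have "(S,T) \<in> tens_basis n p q" using v by (simp add: tens_space_def)
      then show False using False that unfolding tens_basis_def ext_basis_def by auto
    qed
    then have "ext_act n g v (S',T') = 0" by (auto simp: ext_act_def intro!: sum.neutral)
    then show ?thesis using False by (simp add: tens_act_def)
  qed
qed

lemma linear_ext_act: "Vector_Spaces.linear fscale fscale (ext_act n g :: 'k::field pvec \<Rightarrow> _)"
  unfolding linear_fscale_iff
  by (auto simp: ext_act_def fun_eq_iff case_prod_unfold algebra_simps sum.distrib sum_distrib_left)

lemma ext_act_wspace: "v \<in> wspace n N q \<Longrightarrow> ext_act n g v \<in> wspace n N q"
  unfolding wspace_def
proof (intro CollectI allI impI)
  fix S' T'
  assume v: "v \<in> {v. \<forall>S T. v (S, T) \<noteq> 0 \<longrightarrow> S \<subseteq> {..<n} \<and> T \<subseteq> {..<n} \<and> card S + card T = N \<and> card T = q}"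
    and nz: "ext_act n g v (S',T') \<noteq> 0"
  then have S': "S' \<subseteq> {..<n}" "T' \<subseteq> {..<n}" by (auto simp: ext_act_def split: if_splits)
  with nz obtain S T where "(S,T) \<in> tens_basis n (card S') (card T')" "v (S,T) \<noteq> 0"
    by (auto simp: ext_act_def elim!: sum.not_neutral_contains_not_neutral)
  moreover from this have "card S + card T = N" "card T = q" using v by blast+
  ultimately show "S' \<subseteq> {..<n} \<and> T' \<subseteq> {..<n} \<and> card S' + card T' = N \<and> card T' = q"
    using S' by (simp add: tens_basis_def ext_basis_def)
qed

text \<open>Comparing coefficients, the claim becomes \<open>minor_exchange\<close> for each source
  pair, followed by a reindexing of the sources.\<close>

lemma transfer_ext_act:
  fixes g :: "'k::field mat" and v :: "'k pvec"
  assumes g: "g \<in> carrier_mat n n" and \<alpha>\<beta>: "\<alpha> = below \<or> \<alpha> = above" "\<beta> = below \<or> \<beta> = above"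
  shows "transfer \<alpha> \<beta> (ext_act n g v) = ext_act n g (transfer \<alpha> \<beta> v)"
proof (rule ext, clarify)
  fix S' T'
  show "transfer \<alpha> \<beta> (ext_act n g v) (S',T') = ext_act n g (transfer \<alpha> \<beta> v) (S',T')"
  proof (cases "S' \<subseteq> {..<n} \<and> T' \<subseteq> {..<n}")
    case False
    then have "ext_act n g v (S' - {s}, insert s T') = 0" if "s \<in> S'" for s
      using that by (auto simp: ext_act_def)
    then show ?thesis using False by (auto simp: transfer_def ext_act_def)
  next
    case ST': True
    then have fin: "finite S'" "finite T'" using finite_subset by auto
    let ?B = "\<lambda>p q. tens_basis n p q"
    have finB: "finite (?B p q)" for p q by (simp add: tens_basis_def ext_basis_def)
    have fin': "finite S" "finite T" if "(S,T) \<in> ?B p q" for S T p q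
      using that finite_subset by (auto simp: tens_basis_def ext_basis_def)
    show ?thesis
    proof (cases "card S'")
      \<comment> \<open>Nothing can be moved out of an empty first set; beyond this case the source
        degree is the predecessor \<open>p\<close>.\<close>
      case 0
      then have "S' = {}" using fin by simp
      moreover have "transfer \<alpha> \<beta> v (S,T) = 0" if "(S,T) \<in> ?B 0 q" for S T q
        using fin'[OF that] that by (auto simp: transfer_def tens_basis_def ext_basis_def)
      ultimately have "ext_act n g (transfer \<alpha> \<beta> v) (S',T') = 0"
        by (auto simp: ext_act_def intro!: sum.neutral)
      then show ?thesis using \<open>S' = {}\<close> by (simp add: transfer_def)
    next
      case (Suc p)
      let ?q = "card T'"
      let ?d = "\<lambda>A B. det (submatrix g A B)"
      let ?c = "\<lambda>S r T. (-1) ^ (\<alpha> S r + \<beta> T r) :: 'k"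
      have "transfer \<alpha> \<beta> (ext_act n g v) (S',T') =
        (\<Sum>s\<in>S' - T'. ?c S' s T' * (\<Sum>(S,T)\<in>?B p (Suc ?q). ?d (S' - {s}) S * ?d (insert s T') T * v (S,T)))"
        unfolding transfer_def prod.case
      proof (rule sum.cong[OF refl])
        fix s assume s: "s \<in> S' - T'"
        then have "S' - {s} \<subseteq> {..<n}" "insert s T' \<subseteq> {..<n}" "card (S' - {s}) = p" "card (insert s T') = Suc ?q"
          using ST' fin Suc s by (simp_all add: subset_insertI2 subset_iff)
        then show "?c S' s T' * ext_act n g v (S' - {s}, insert s T') =
          ?c S' s T' * (\<Sum>(S,T)\<in>?B p (Suc ?q). ?d (S' - {s}) S * ?d (insert s T') T * v (S,T))"
          by (simp add: ext_act_def)
      qed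
      also have "\<dots> = (\<Sum>s\<in>S' - T'. \<Sum>x\<in>?B p (Suc ?q).
          ?c S' s T' * (?d (S' - {s}) (fst x) * ?d (insert s T') (snd x)) * v x)"
        by (simp add: sum_distrib_left case_prod_unfold mult.assoc)
      also have "\<dots> = (\<Sum>x\<in>?B p (Suc ?q). \<Sum>s\<in>S' - T'.
          ?c S' s T' * (?d (S' - {s}) (fst x) * ?d (insert s T') (snd x)) * v x)"
        by (rule sum.swap)
      also have "\<dots> = (\<Sum>x\<in>?B p (Suc ?q). \<Sum>r\<in>snd x - fst x.
          ?c (fst x) r (snd x) * (?d S' (insert r (fst x)) * ?d T' (snd x - {r})) * v x)"
      proof (rule sum.cong[OF refl])
        fix x assume "x \<in> ?B p (Suc ?q)"
        then have x: "fst x \<subseteq> {..<n}" "snd x \<subseteq> {..<n}" "card (fst x) = p" "card (snd x) = Suc ?q"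
          by (auto simp: tens_basis_def ext_basis_def)
        show "(\<Sum>s\<in>S' - T'. ?c S' s T' * (?d (S' - {s}) (fst x) * ?d (insert s T') (snd x)) * v x)
          = (\<Sum>r\<in>snd x - fst x. ?c (fst x) r (snd x) * (?d S' (insert r (fst x)) * ?d T' (snd x - {r})) * v x)"
          unfolding sum_distrib_right[symmetric]
          using minor_exchange[OF g \<alpha>\<beta>, of S' "fst x" T' "snd x"] ST' x Suc by simp
      qed
      also have "\<dots> = (\<Sum>(x,r)\<in>(SIGMA x:?B p (Suc ?q). snd x - fst x).
          ?c (fst x) r (snd x) * (?d S' (insert r (fst x)) * ?d T' (snd x - {r})) * v x)"
        by (rule sum.Sigma) (use finB fin' in auto)
      also have "\<dots> = (\<Sum>(y,r)\<in>(SIGMA y:?B (Suc p) ?q. fst y - snd y).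
          ?d S' (fst y) * ?d T' (snd y) * (?c (fst y) r (snd y) * v (fst y - {r}, insert r (snd y))))"
      proof (rule sum.reindex_bij_witness[where
            i = "\<lambda>(y,r). ((fst y - {r}, insert r (snd y)), r)" and
            j = "\<lambda>(x,r). ((insert r (fst x), snd x - {r}), r)"], goal_cases)
        case (1 z)
        then show ?case by auto
      next
        case (2 z)
        then obtain S T r where z: "z = ((S,T),r)" "(S,T) \<in> ?B p (Suc ?q)" "r \<in> T" "r \<notin> S" by auto
        from fin'[OF z(2)] z show ?case by (auto simp: tens_basis_def ext_basis_def)
      next
        case (3 z)
        then show ?case by auto
      next
        case (4 z)
        then obtain S T r where z: "z = ((S,T),r)" "(S,T) \<in> ?B (Suc p) ?q" "r \<in> S" "r \<notin> T" by auto
        from fin'[OF z(2)] z show ?case by (auto simp: tens_basis_def ext_basis_def)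
      next
        case (5 z)
        then obtain S T r where z: "z = ((S,T),r)" "r \<in> T" "r \<notin> S" by auto
        \<comment> \<open>Strict inequalities make the signs insensitive to the presence of
          \<open>r\<close> itself.\<close>
        have "{x \<in> insert r S. x < r} = {x \<in> S. x < r}" "{x \<in> insert r S. r < x} = {x \<in> S. r < x}"
          "{x \<in> T - {r}. x < r} = {x \<in> T. x < r}" "{x \<in> T - {r}. r < x} = {x \<in> T. r < x}" by auto
        then have "\<alpha> (insert r S) r = \<alpha> S r" "\<beta> (T - {r}) r = \<beta> T r"
          using \<alpha>\<beta> by (elim disjE; simp)+
        moreover have "insert r S - {r} = S" "insert r (T - {r}) = T" using z by auto
        ultimately show ?case using z by (simp add: ac_simps)
      qed
      also have "\<dots> = (\<Sum>y\<in>?B (Suc p) ?q. \<Sum>r\<in>fst y - snd y.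
          ?d S' (fst y) * ?d T' (snd y) * (?c (fst y) r (snd y) * v (fst y - {r}, insert r (snd y))))"
        by (rule sum.Sigma[symmetric]) (use finB fin' in auto)
      also have "\<dots> = ext_act n g (transfer \<alpha> \<beta> v) (S',T')"
        using ST' Suc by (simp add: ext_act_def transfer_def case_prod_unfold sum_distrib_left)
      finally show ?thesis .
    qed
  qed
qed

text \<open>For a single moved element the inversions are counted by the elements of
  \<open>S\<close> above it and those of \<open>T\<close> below it.\<close>

lemma wsign_move1:
  assumes "finite S" "finite T" "s \<in> S" "s \<notin> T"
  shows "wsign S T * wsign (S - {s}) (insert s T) = ((-1) ^ (above S s + below T s) :: 'k::field)"
proof -
  have "{(x,t). x \<in> S - {s} \<and> t \<in> {s} \<and> t < x} = (\<lambda>x. (x, s)) ` {x \<in> S. s < x}" by auto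
  then have "card {(x,t). x \<in> S - {s} \<and> t \<in> {s} \<and> t < x} = above S s"
    by (simp add: card_image inj_on_def)
  moreover have "{(x,t). x \<in> {s} \<and> t \<in> T \<and> t < x} = (\<lambda>t. (s, t)) ` {t \<in> T. t < s}" by auto
  then have "card {(x,t). x \<in> {s} \<and> t \<in> T \<and> t < x} = below T s"
    by (simp add: card_image inj_on_def)
  ultimately have "wsign (S - {s}) {s} * wsign {s} T = ((-1) ^ (above S s + below T s) :: 'k)"
    by (simp only: wsign_def power_add)
  moreover have "wsign S T * wsign (S - {s}) (T \<union> {s}) = (wsign (S - {s}) {s} * wsign {s} T :: 'k)"
    by (rule wsign_move) (use assms in auto)
  ultimately show ?thesis by simp
qed

lemma ext_E_eq_transfer:
  fixes v :: "'k::field pvec"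
  assumes v: "v \<in> wspace n N q"
  shows "ext_E v = transfer above below v"
proof (rule ext, clarify)
  fix S T
  have eq: "wsign S T * (wsign (S - {s}) (insert s T) * v (S - {s}, insert s T))
      = (-1) ^ (above S s + below T s) * v (S - {s}, insert s T)" if s: "s \<in> S - T" for s
  proof (cases "v (S - {s}, insert s T) = 0")
    case False
    note sub = wspaceD(1,2)[OF v False]
    have "finite (S - {s})" "finite (insert s T)"
      by (rule finite_subset[OF sub(1)], simp) (rule finite_subset[OF sub(2)], simp)
    then have "finite S" "finite T" by simp_all
    then have "wsign S T * wsign (S - {s}) (insert s T) = ((-1) ^ (above S s + below T s) :: 'k)"
      using s by (intro wsign_move1) auto
    then show ?thesis by (simp add: mult.assoc[symmetric])
  qed simp
  show "ext_E v (S,T) = transfer above below v (S,T)"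
    by (simp add: ext_E_def transfer_def twist_def raise_def sum_distrib_left)
      (rule sum.cong[OF refl eq])
qed

lemma ext_F_eq_transfer:
  fixes v :: "'k::field pvec"
  assumes v: "v \<in> wspace n N q"
  shows "ext_F v = transfer below above (v \<circ> prod.swap) \<circ> prod.swap"
proof (rule ext, clarify)
  fix S T
  have eq: "wsign S T * (wsign (insert s S) (T - {s}) * v (insert s S, T - {s}))
      = (-1) ^ (below T s + above S s) * v (insert s S, T - {s})" if s: "s \<in> T - S" for s
  proof (cases "v (insert s S, T - {s}) = 0")
    case False
    note sub = wspaceD(1,2)[OF v False]
    have "finite (insert s S)" "finite (T - {s})"
      by (rule finite_subset[OF sub(1)], simp) (rule finite_subset[OF sub(2)], simp)
    moreover have "insert s S - {s} = S" "insert s (T - {s}) = T" using s by auto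
    moreover have "above (insert s S) s = above S s" "below (T - {s}) s = below T s"
      by (auto intro!: arg_cong[where f = card])
    ultimately have "wsign S T * wsign (insert s S) (T - {s}) = ((-1) ^ (below T s + above S s) :: 'k)"
      using wsign_move1[of "insert s S" "T - {s}" s] s by (simp add: ac_simps)
    then show ?thesis by (simp add: mult.assoc[symmetric])
  qed simp
  show "ext_F v (S,T) = (transfer below above (v \<circ> prod.swap) \<circ> prod.swap) (S,T)"
    by (simp add: ext_F_def transfer_def twist_def lower_def sum_distrib_left)
      (rule sum.cong[OF refl eq])
qed

lemma ext_act_swap: "ext_act n g (v \<circ> prod.swap) = ext_act n g v \<circ> prod.swap"
proof (rule ext, clarify)
  fix S' T'
  have "(\<Sum>(S,T)\<in>tens_basis n (card S') (card T'). det (submatrix g S' S) * det (submatrix g T' T) * v (T,S))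
    = (\<Sum>(T,S)\<in>tens_basis n (card T') (card S'). det (submatrix g T' T) * det (submatrix g S' S) * v (T,S))"
    by (rule sum.reindex_bij_witness[where i = prod.swap and j = prod.swap])
      (auto simp: tens_basis_def mult.commute)
  then show "ext_act n g (v \<circ> prod.swap) (S',T') = (ext_act n g v \<circ> prod.swap) (S',T')"
    by (simp add: ext_act_def)
qed

lemma ext_act_ext_E:
  assumes "g \<in> carrier_mat n n" "v \<in> wspace n N q"
  shows "ext_act n g (ext_E v) = ext_E (ext_act n g v)"
  using assms transfer_ext_act[OF assms(1), of above below v]
  by (simp add: ext_E_eq_transfer[OF assms(2)] ext_E_eq_transfer[OF ext_act_wspace[OF assms(2)]])

lemma ext_act_ext_F:
  assumes "g \<in> carrier_mat n n" "v \<in> wspace n N q"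
  shows "ext_act n g (ext_F v) = ext_F (ext_act n g v)"
  using assms transfer_ext_act[OF assms(1), of below above "v \<circ> prod.swap"]
  by (simp add: ext_F_eq_transfer[OF assms(2)] ext_F_eq_transfer[OF ext_act_wspace[OF assms(2)]] ext_act_swap)

section \<open>Quotients and weights\<close>

interpretation fun_space: vector_space fscale
  by (rule vector_space_fscale)

lemma coset_eq_iff:
  assumes W: "fun_space.subspace W"
  shows "coset W u = coset W v \<longleftrightarrow> u - v \<in> W"
proof
  assume eq: "coset W u = coset W v"
  have "u \<in> coset W u" using fun_space.subspace_0[OF W] by (auto simp: coset_def intro!: image_eqI[of _ _ 0])
  then obtain w where "w \<in> W" "u = (\<lambda>x. v x + w x)" unfolding eq by (auto simp: coset_def)
  then show "u - v \<in> W" by (simp add: fun_diff_def)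
next
  assume d: "u - v \<in> W"
  have "coset W u \<subseteq> coset W v" if "u - v \<in> W" for u v
  proof
    fix x assume "x \<in> coset W u"
    then obtain w where w: "w \<in> W" "x = (\<lambda>y. u y + w y)" by (auto simp: coset_def)
    have "(u - v) + w \<in> W" using that w fun_space.subspace_add[OF W] by blast
    then show "x \<in> coset W v" using w(2)
      by (auto simp: coset_def fun_eq_iff intro!: image_eqI[of _ _ "(u - v) + w"])
  qed
  moreover have "v - u \<in> W" using fun_space.subspace_neg[OF W d] by simp
  ultimately show "coset W u = coset W v" using d by blast
qed

text \<open>The isomorphism theorem for \<open>\<phi>\<close> followed by passage to the quotient by
  \<open>W'\<close>; the hypothesis \<open>ker\<close> gives both independence of representatives
  and injectivity.\<close>

lemma quot_isoI:
  fixes act :: "'g \<Rightarrow> ('a \<Rightarrow> 'k::field) \<Rightarrow> 'a \<Rightarrow> 'k" and act' :: "'g \<Rightarrow> ('b \<Rightarrow> 'k) \<Rightarrow> 'b \<Rightarrow> 'k"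
  assumes V: "fun_space.subspace V" and V': "fun_space.subspace V'"
    and W: "fun_space.subspace W" and W': "fun_space.subspace W'"
    and maps: "\<And>v. v \<in> V \<Longrightarrow> \<phi> v \<in> V'"
    and lin: "\<And>a u v. u \<in> V \<Longrightarrow> v \<in> V \<Longrightarrow> \<phi> (fscale a u + v) = fscale a (\<phi> u) + \<phi> v"
    and ker: "\<And>v. v \<in> V \<Longrightarrow> \<phi> v \<in> W' \<longleftrightarrow> v \<in> W"
    and surj: "\<And>w. w \<in> V' \<Longrightarrow> \<exists>v\<in>V. \<phi> v - w \<in> W'"
    and act: "\<And>g v. g \<in> G \<Longrightarrow> v \<in> V \<Longrightarrow> act g v \<in> V"
    and equiv: "\<And>g v. g \<in> G \<Longrightarrow> v \<in> V \<Longrightarrow> \<phi> (act g v) = act' g (\<phi> v)"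
    and act_diff: "\<And>g u v. g \<in> G \<Longrightarrow> u \<in> V' \<Longrightarrow> v \<in> V' \<Longrightarrow> act' g (u - v) = act' g u - act' g v"
    and act_W': "\<And>g w. g \<in> G \<Longrightarrow> w \<in> W' \<Longrightarrow> act' g w \<in> W'"
  shows "quot_iso G act V W act' V' W'"
proof -
  have diff: "\<phi> (u - v) = \<phi> u - \<phi> v" if "u \<in> V" "v \<in> V" for u v
    using lin[OF that(2,1), of "- 1"] by (simp add: fun_eq_iff fscale_def plus_fun_def fun_diff_def)
  define F where "F C = coset W' (\<phi> (SOME v. v \<in> V \<and> coset W v = C))" for C
  have F: "F (coset W v) = coset W' (\<phi> v)" if v: "v \<in> V" for v
  proof -
    let ?u = "SOME u. u \<in> V \<and> coset W u = coset W v"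
    have u: "?u \<in> V \<and> coset W ?u = coset W v" by (rule someI[of _ v]) (use v in simp)
    then have "?u - v \<in> W" using coset_eq_iff[OF W] by blast
    then have "\<phi> ?u - \<phi> v \<in> W'"
      using ker[of "?u - v"] diff[of ?u v] u v fun_space.subspace_diff[OF V] by auto
    then show ?thesis unfolding F_def by (simp add: coset_eq_iff[OF W'])
  qed
  have rel: "F (coset W v) = coset W' v' \<longleftrightarrow> \<phi> v - v' \<in> W'" if "v \<in> V" for v v'
    by (simp add: F[OF that] coset_eq_iff[OF W'])
  show ?thesis unfolding quot_iso_def
  proof (intro exI[of _ F] conjI ballI allI impI)
    show "bij_betw F (quot V W) (quot V' W')"
    proof (rule bij_betwI')
      fix C D assume C: "C \<in> quot V W" and D: "D \<in> quot V W"
      obtain u v where uv: "u \<in> V" "v \<in> V" "C = coset W u" "D = coset W v"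
        using C D unfolding quot_def by blast
      have "F C = F D \<longleftrightarrow> \<phi> (u - v) \<in> W'" using uv by (simp add: F coset_eq_iff[OF W'] diff)
      also have "\<dots> \<longleftrightarrow> C = D" using uv ker fun_space.subspace_diff[OF V] by (simp add: coset_eq_iff[OF W])
      finally show "F C = F D \<longleftrightarrow> C = D" .
    next
      fix C assume "C \<in> quot V W"
      then show "F C \<in> quot V' W'" using F maps unfolding quot_def by auto
    next
      fix D assume "D \<in> quot V' W'"
      then obtain w where w: "w \<in> V'" "D = coset W' w" unfolding quot_def by blast
      obtain v where "v \<in> V" "\<phi> v - w \<in> W'" using surj[OF w(1)] by blast
      then show "\<exists>C\<in>quot V W. D = F C" using rel[of v w] w(2) unfolding quot_def by auto
    qed
  next
    fix u v c u' v'
    assume u: "u \<in> V" and v: "v \<in> V" and "F (coset W u) = coset W' u'" "F (coset W v) = coset W' v'"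
    then have d: "\<phi> u - u' \<in> W'" "\<phi> v - v' \<in> W'" using rel by auto
    have e: "(\<lambda>x. c * u x + v x) = fscale c u + v" "(\<lambda>x. c * u' x + v' x) = fscale c u' + v'"
      by (auto simp: fun_eq_iff)
    have "fscale c (\<phi> u - u') + (\<phi> v - v') \<in> W'"
      using d by (intro fun_space.subspace_add fun_space.subspace_scale W')
    then have "\<phi> (fscale c u + v) - (fscale c u' + v') \<in> W'"
      unfolding lin[OF u v] fun_space.scale_right_diff_distrib by (simp add: algebra_simps)
    then show "F (coset W (\<lambda>x. c * u x + v x)) = coset W' (\<lambda>x. c * u' x + v' x)"
      unfolding e using u v fun_space.subspace_add[OF V] fun_space.subspace_scale[OF V] by (subst rel) auto
  next
    fix g v v' assume g: "g \<in> G" and v: "v \<in> V" and v': "v' \<in> V'" and "F (coset W v) = coset W' v'"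
    then have "act' g (\<phi> v - v') \<in> W'" using rel act_W' by blast
    then have "\<phi> (act g v) - act' g v' \<in> W'" using equiv[OF g v] act_diff[OF g maps[OF v] v'] by simp
    then show "F (coset W (act g v)) = coset W' (act' g v')" using rel[OF act[OF g v]] by simp
  qed
qed

text \<open>An isomorphism of quotients becomes a relation on representatives, namely that the coset
  of one is mapped to the coset of the other. This avoids calculating with cosets
  afterwards.\<close>

lemma quot_isoE:
  fixes act :: "'g \<Rightarrow> ('a \<Rightarrow> 'k::field) \<Rightarrow> 'a \<Rightarrow> 'k" and act' :: "'g \<Rightarrow> ('b \<Rightarrow> 'k) \<Rightarrow> 'b \<Rightarrow> 'k"
  assumes iso: "quot_iso G act V W act' V' W'"
    and V: "fun_space.subspace V" and V': "fun_space.subspace V'"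
    and W: "fun_space.subspace W" and W': "fun_space.subspace W'"
    and WV: "W \<subseteq> V" "W' \<subseteq> V'"
  obtains \<rho> where "\<And>v. v \<in> V \<Longrightarrow> \<exists>v'\<in>V'. \<rho> v v'" and "\<And>v'. v' \<in> V' \<Longrightarrow> \<exists>v\<in>V. \<rho> v v'"
    and "\<And>a u v u' v'. u \<in> V \<Longrightarrow> v \<in> V \<Longrightarrow> u' \<in> V' \<Longrightarrow> v' \<in> V' \<Longrightarrow> \<rho> u u' \<Longrightarrow> \<rho> v v' \<Longrightarrow>
       \<rho> (fscale a u + v) (fscale a u' + v')"
    and "\<And>v v'. v \<in> V \<Longrightarrow> v' \<in> V' \<Longrightarrow> \<rho> v v' \<Longrightarrow> v \<in> W \<longleftrightarrow> v' \<in> W'"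
    and "\<And>w w'. w \<in> W \<Longrightarrow> w' \<in> W' \<Longrightarrow> \<rho> w w'"
    and "\<And>g v v'. g \<in> G \<Longrightarrow> v \<in> V \<Longrightarrow> v' \<in> V' \<Longrightarrow> \<rho> v v' \<Longrightarrow> \<rho> (act g v) (act' g v')"
proof -
  obtain F where F: "bij_betw F (quot V W) (quot V' W')"
    and lin0: "\<forall>u\<in>V. \<forall>v\<in>V. \<forall>c. \<forall>u'\<in>V'. \<forall>v'\<in>V'.
      F (coset W u) = coset W' u' \<longrightarrow> F (coset W v) = coset W' v' \<longrightarrow>
      F (coset W (\<lambda>x. c * u x + v x)) = coset W' (\<lambda>x. c * u' x + v' x)"
    and equiv0: "\<forall>g\<in>G. \<forall>v\<in>V. \<forall>v'\<in>V'.
      F (coset W v) = coset W' v' \<longrightarrow> F (coset W (act g v)) = coset W' (act' g v')"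
    using iso unfolding quot_iso_def by (elim exE conjE) (rule that)
  have lin: "F (coset W (fscale c u + v)) = coset W' (fscale c u' + v')"
    if "u \<in> V" "v \<in> V" "u' \<in> V'" "v' \<in> V'" "F (coset W u) = coset W' u'" "F (coset W v) = coset W' v'"
    for u v c u' v' using lin0 that unfolding fscale_def plus_fun_def by blast
  have equiv: "F (coset W (act g v)) = coset W' (act' g v')"
    if "g \<in> G" "v \<in> V" "v' \<in> V'" "F (coset W v) = coset W' v'" for g v v'
    using equiv0 that by blast
  have total: "\<exists>v'\<in>V'. F (coset W v) = coset W' v'" if "v \<in> V" for v
  proof -
    have "F (coset W v) \<in> quot V' W'" using F that unfolding bij_betw_def quot_def by blast
    then show ?thesis unfolding quot_def by blast
  qed
  have "0 \<in> V" "0 \<in> V'" using V V' by (simp_all add: fun_space.subspace_0)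
  have zero: "F (coset W 0) = coset W' 0"
  proof -
    obtain z where z: "z \<in> V'" "F (coset W 0) = coset W' z" using total[OF \<open>0 \<in> V\<close>] by blast
    \<comment> \<open>Linearity, stated on representatives, gives that \<open>z\<close> and
      \<open>z + z\<close> are congruent modulo \<open>W'\<close>, hence that the zero class goes to
      the zero class.\<close>
    have "F (coset W (fscale 1 0 + 0)) = coset W' (fscale 1 z + z)"
      using lin[OF \<open>0 \<in> V\<close> \<open>0 \<in> V\<close> z(1) z(1) z(2) z(2)] .
    then have "coset W' z = coset W' (z + z)" using z(2) by simp
    then have "z - (z + z) \<in> W'" using coset_eq_iff[OF W'] by blast
    then have "z - 0 \<in> W'" using fun_space.subspace_neg[OF W'] by fastforce
    then show ?thesis using z(2) coset_eq_iff[OF W'] by metis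
  qed
  show thesis
  proof (rule that[of "\<lambda>v v'. F (coset W v) = coset W' v'"])
    show "\<exists>v'\<in>V'. F (coset W v) = coset W' v'" if "v \<in> V" for v by (rule total[OF that])
    show "\<exists>v\<in>V. F (coset W v) = coset W' v'" if "v' \<in> V'" for v'
    proof -
      have "coset W' v' \<in> F ` quot V W" using F that unfolding bij_betw_def quot_def by blast
      then show ?thesis unfolding quot_def by (metis imageE)
    qed
    show "F (coset W (fscale a u + v)) = coset W' (fscale a u' + v')"
      if "u \<in> V" "v \<in> V" "u' \<in> V'" "v' \<in> V'" "F (coset W u) = coset W' u'" "F (coset W v) = coset W' v'"
      for a u v u' v'
      using lin[OF that] .
    show "v \<in> W \<longleftrightarrow> v' \<in> W'" if "v \<in> V" "v' \<in> V'" "F (coset W v) = coset W' v'" for v v'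
    proof -
      have "v \<in> W \<longleftrightarrow> coset W v = coset W 0" by (simp add: coset_eq_iff[OF W])
      also have "\<dots> \<longleftrightarrow> F (coset W v) = F (coset W 0)"
        using F that(1) \<open>0 \<in> V\<close> unfolding bij_betw_def quot_def by (auto dest: inj_onD)
      also have "\<dots> \<longleftrightarrow> v' \<in> W'" by (simp add: that(3) zero coset_eq_iff[OF W'])
      finally show ?thesis .
    qed
    show "F (coset W w) = coset W' w'" if "w \<in> W" "w' \<in> W'" for w w'
    proof -
      have "coset W w = coset W 0" "coset W' w' = coset W' 0"
        using that by (simp_all add: coset_eq_iff[OF W] coset_eq_iff[OF W'])
      then show ?thesis using zero by simp
    qed
    show "F (coset W (act g v)) = coset W' (act' g v')"
      if "g \<in> G" "v \<in> V" "v' \<in> V'" "F (coset W v) = coset W' v'" for g v v'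
      using equiv[OF that] .
  qed
qed

section \<open>Diagonal matrices and dominance of weights\<close>

definition diagonal :: "nat \<Rightarrow> (nat \<Rightarrow> 'k::field) \<Rightarrow> 'k mat" where
  "diagonal n d = mat n n (\<lambda>(i,j). if i = j then d i else 0)"

lemma diagonal_carrier [simp]: "diagonal n d \<in> carrier_mat n n"
  by (simp add: diagonal_def)

lemma diagonal_mult: "diagonal n d * diagonal n e = diagonal n (\<lambda>i. d i * e i)"
  by (rule eq_matI) (auto simp: diagonal_def scalar_prod_def if_distrib[of "\<lambda>x. x * _"] cong: if_cong)

lemma diagonal_GL:
  assumes "\<And>i. d i \<noteq> 0"
  shows "diagonal n d \<in> GL n"
proof -
  have "diagonal n d * diagonal n (\<lambda>i. inverse (d i)) = 1\<^sub>m n"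
    "diagonal n (\<lambda>i. inverse (d i)) * diagonal n d = 1\<^sub>m n"
    using assms by (simp_all add: diagonal_mult) (simp_all add: diagonal_def one_mat_def)
  then have "inverts_mat (diagonal n d) (diagonal n (\<lambda>i. inverse (d i)))"
    "inverts_mat (diagonal n (\<lambda>i. inverse (d i))) (diagonal n d)"
    by (simp_all add: inverts_mat_def diagonal_def)
  then show ?thesis unfolding GL_def invertible_mat_def by (auto simp: square_mat.simps diagonal_def)
qed

text \<open>Induction on the row set: in the expansion along row \<open>s\<close> only column
  \<open>s\<close> survives, and its sign cancels when the remaining index sets agree.\<close>

lemma det_submatrix_diagonal:
  assumes "finite A" "A \<subseteq> {..<n}" "B \<subseteq> {..<n}" "card A = card B"
  shows "det (submatrix (diagonal n d) A B) = (if A = B then \<Prod>i\<in>A. d i else (0::'k::field))"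
  using assms
proof (induction A arbitrary: B rule: finite_induct)
  case empty
  then have "B = {}" using finite_subset[of B "{..<n}"] by auto
  then show ?case using submatrix_carrier[OF diagonal_carrier, of "{}" n "{}" d] by (simp add: det_dim_zero)
next
  case (insert s C)
  have fin: "finite B" using insert.prems finite_subset by blast
  have cB: "card B = Suc (card C)" using insert by simp
  have s: "s < n" and C: "C \<subseteq> {..<n}" using insert.prems by auto
  let ?D = "\<lambda>A B. det (submatrix (diagonal n d) A B)"
  have "(-1) ^ below C s * ?D (insert s C) B = (\<Sum>r\<in>B. (-1) ^ below B r * diagonal n d $$ (s, r) * ?D C (B - {r}))"
    using minor_row_expansion[OF diagonal_carrier C insert.prems(2) cB s, of d] insert.hyps by simp
  also have "\<dots> = (\<Sum>r\<in>B. if r = s then (-1) ^ below B s * d s * ?D C (B - {s}) else 0)"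
    by (rule sum.cong) (use insert.prems s in \<open>auto simp: diagonal_def\<close>)
  also have "\<dots> = (if s \<in> B then (-1) ^ below B s * d s * ?D C (B - {s}) else 0)"
    using fin by simp
  finally have eq: "(-1) ^ below C s * ?D (insert s C) B = (if s \<in> B then (-1) ^ below B s * d s * ?D C (B - {s}) else 0)" .
  show ?case
  proof (cases "s \<in> B")
    case False
    then show ?thesis using eq by auto
  next
    case True
    have IH: "?D C (B - {s}) = (if C = B - {s} then \<Prod>i\<in>C. d i else 0)"
      using insert.prems fin True cB C by (intro insert.IH) auto
    have iff: "C = B - {s} \<longleftrightarrow> insert s C = B" using True insert.hyps by auto
    have "below B s = below C s" if "C = B - {s}" unfolding that by (rule arg_cong[where f = card]) auto
    then have "(-1) ^ below C s * ?D (insert s C) B = (-1) ^ below C s * (if insert s C = B then d s * (\<Prod>i\<in>C. d i) else 0)"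
      using eq True IH iff by auto
    then show ?thesis using insert.hyps by auto
  qed
qed

lemma ext_act_diagonal:
  assumes v: "v \<in> wspace n N q"
  shows "ext_act n (diagonal n d) v (S,T) = (\<Prod>i\<in>S. d i) * (\<Prod>i\<in>T. d i) * v (S,T)"
proof (cases "S \<subseteq> {..<n} \<and> T \<subseteq> {..<n}")
  case True
  let ?B = "tens_basis n (card S) (card T)"
  have fin: "finite ?B" by (simp add: tens_basis_def ext_basis_def)
  have B: "(S,T) \<in> ?B" using True by (simp add: tens_basis_def ext_basis_def)
  have "ext_act n (diagonal n d) v (S,T) =
    (\<Sum>x\<in>?B. if x = (S,T) then (\<Prod>i\<in>S. d i) * (\<Prod>i\<in>T. d i) * v (S,T) else 0)"
    unfolding ext_act_def
  proof (simp add: True case_prod_unfold, intro sum.cong[OF refl])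
    fix x assume "x \<in> ?B"
    then have x: "fst x \<subseteq> {..<n}" "snd x \<subseteq> {..<n}" "card (fst x) = card S" "card (snd x) = card T"
      by (auto simp: tens_basis_def ext_basis_def)
    have "finite S" "finite T" using True finite_subset by auto
    then show "det (submatrix (diagonal n d) S (fst x)) * det (submatrix (diagonal n d) T (snd x)) * v x =
        (if x = (S,T) then (\<Prod>i\<in>S. d i) * (\<Prod>i\<in>T. d i) * v (S,T) else 0)"
      using x True by (cases x) (auto simp: det_submatrix_diagonal)
  qed
  then show ?thesis using fin B by simp
next
  case False
  then show ?thesis using wspace_outside[OF v False] by (auto simp: ext_act_def)
qed

text \<open>Among sets of given size the initial segment has the least sum: the maximum
  \<open>m\<close> is at least the number of elements below it.\<close>

lemma sum_lessThan_card_le: "finite S \<Longrightarrow> \<Sum>{..<card S} \<le> \<Sum>S" for S :: "nat set"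
proof (induction S rule: finite_linorder_max_induct)
  case (insert m A)
  have "card A \<le> card {..<m}" using insert.hyps by (intro card_mono) auto
  moreover have "m \<notin> A" using insert.hyps by auto
  ultimately show ?case using insert by simp
qed simp

text \<open>Passing from \<open>k\<close> to \<open>k + 1\<close> replaces the element
  \<open>b - k - 1\<close> of the second segment by the larger element \<open>a + k\<close> in the
  first.\<close>

lemma dominance_sum_less:
  fixes a b :: nat
  assumes "b \<le> a" "j < k" "k \<le> b"
  shows "\<Sum>{..<a + j} + \<Sum>{..<b - j} < \<Sum>{..<a + k} + \<Sum>{..<b - k}"
  using assms(2,3)
proof (induction k)
  case (Suc k)
  have "b - k = Suc (b - Suc k)" using Suc.prems by simp
  then have "\<Sum>{..<a + k} + \<Sum>{..<b - k} < \<Sum>{..<a + Suc k} + \<Sum>{..<b - Suc k}"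
    using assms(1) by simp
  then show ?case using Suc by (cases "j = k") auto
qed simp

text \<open>In characteristic zero the powers of 2 are distinct, so an eigenvalue
  \<open>2 ^ m\<close> determines \<open>m\<close>.\<close>

lemma two_power_eq_iff: "2 ^ m = (2 ^ m' :: 'k::field_char_0) \<longleftrightarrow> m = m'"
proof
  assume "2 ^ m = (2 ^ m' :: 'k)"
  then have "of_nat (2 ^ m) = (of_nat (2 ^ m') :: 'k)" by simp
  then have "(2::nat) ^ m = 2 ^ m'" by (simp only: of_nat_eq_iff)
  then show "m = m'" by simp
qed simp

lemma wspace_subset_span:
  "\<exists>B. finite B \<and> (wspace n N q :: 'k::field pvec set) \<subseteq> fun_space.span B"
proof -
  let ?P = "Pow {..<n} \<times> Pow {..<n}"
  let ?u = "\<lambda>x y. if y = x then 1 else 0 :: 'k"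
  have "v \<in> fun_space.span (?u ` ?P)" if v: "v \<in> wspace n N q" for v
  proof -
    have "v = (\<Sum>x\<in>?P. fscale (v x) (?u x))"
    proof (rule ext)
      fix y
      have "(\<Sum>x\<in>?P. fscale (v x) (?u x)) y = (\<Sum>x\<in>?P. if y = x then v x else 0)"
        unfolding sum_fun_apply by (rule sum.cong) auto
      also have "\<dots> = (if y \<in> ?P then v y else 0)" by simp
      also have "\<dots> = v y" using wspace_outside[OF v, of "fst y" "snd y"] by (auto simp: mem_Times_iff)
      finally show "v y = (\<Sum>x\<in>?P. fscale (v x) (?u x)) y" ..
    qed
    also have "\<dots> \<in> fun_space.span (?u ` ?P)"
      by (intro fun_space.span_sum fun_space.span_scale fun_space.span_base imageI)
    finally show ?thesis .
  qed
  then show ?thesis by (intro exI[of _ "?u ` ?P"]) auto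
qed

definition hw :: "nat \<Rightarrow> nat \<Rightarrow> nat \<Rightarrow> 'k::field pvec" where
  "hw a b j = (\<lambda>x. if x = ({..<a + j}, {..<b - j}) then 1 else 0)"

lemma hw_wspace: "j \<le> b \<Longrightarrow> a + b \<le> n \<Longrightarrow> hw a b j \<in> wspace n (a + b) (b - j)"
  by (rule wspaceI) (auto simp: hw_def split: if_splits)

text \<open>Since \<open>b \<le> a\<close>, every basis vector in the second factor already occurs
  in the first, so moving it there gives zero.\<close>

lemma ext_E_hw:
  assumes "b \<le> a" "j \<le> b" "a + b \<le> n"
  shows "ext_E (hw a b j) = (0 :: 'k::field pvec)"
proof -
  have "hw a b j (S - {s}, insert s T) = (0 :: 'k)" for S T s
  proof -
    have False if "S - {s} = {..<a + j}" "insert s T = {..<b - j}"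
    proof -
      have "s < b - j" using that(2) by auto
      then have "s \<in> {..<a + j}" using assms(1) by simp
      then show False using that(1) by auto
    qed
    then show ?thesis by (auto simp: hw_def)
  qed
  then show ?thesis
    unfolding ext_E_eq_transfer[OF hw_wspace[OF assms(2,3)]] by (auto simp: transfer_def fun_eq_iff)
qed

theorem theorem3p5:
  fixes n a b i :: nat and c :: "nat \<Rightarrow> 'k::field_char_0"
  assumes "b \<le> a" and "a + b \<le> n" and "i \<le> b"
  shows "quot_iso (GL n) (tens_act n a b) (tens_space n a b) (Phi_image n a b c)
                 (tens_act n (a + i) (b - i)) (tens_space n (a + i) (b - i)) (schur_rel n (a + i) (b - i))
     \<longleftrightarrow> ((\<Sum>t\<in>{0..i}. c t * ccoef a b i t) = 0 \<and>
          (\<forall>j\<in>{0..b} - {i}. (\<Sum>t\<in>{0..j}. c t * ccoef a b j t) \<noteq> 0))"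
proof -
  interpret sl2_weights fscale "ext_E :: 'k pvec \<Rightarrow> _" ext_F "wspace n (a + b)" "a + b"
    by (rule sl2_weights_ext)
  let ?X = "\<lambda>q. wspace n (a + b) q :: 'k pvec set"
  have b: "2 * b \<le> a + b" using assms(1) by simp
  \<comment> \<open>All tensor products in play have total degree \<open>a + b\<close>, so they are
    weight spaces of one and the same action.\<close>
  have tens: "tens_space n (a + j) (b - j) = ?X (b - j)" if "j \<le> b" for j
    using that by (simp add: tens_space_eq_wspace)
  have tens0: "tens_space n a b = ?X b" using tens[of 0] by simp
  have eig: "eig c b j = (\<Sum>t\<in>{0..j}. c t * ccoef a b j t)" for j
  proof -
    have "a + b - 2 * b = a - b" by simp
    then show ?thesis unfolding eig_def ccoef_def by (simp add: atLeast0AtMost)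
  qed
  have Phi_map: "Phi_map n a b t v = fscale (1 / (fact t * fact t)) ((ext_F ^^ t) ((ext_E ^^ t) v))"
    if v: "v \<in> ?X b" and t: "t \<le> b" for t v
  proof -
    have d: "delta_map n a b t v = fscale (inverse (fact t)) ((ext_E ^^ t) v)"
      by (rule delta_map_eq) (use v tens0 in simp)
    \<comment> \<open>For \<open>t \<le> b\<close> the degree \<open>b - t\<close> is not truncated,
      so the intermediate vector lies in the space for which \<open>theta_map_eq\<close> is
      stated.\<close>
    have "(ext_E ^^ t) v \<in> ?X (b - t)" using v t by (intro Epow_X) simp
    then have "delta_map n a b t v \<in> tens_space n (a + t) (b - t)"
      unfolding d tens[OF t] by (rule fun_space.subspace_scale[OF subspace_X])
    from theta_map_eq[OF this, of t] show ?thesis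
      unfolding Phi_map_def d by (simp add: Fpow.scale inverse_eq_divide)
  qed
  have "Phi_comb n a b c v = Phi c b v" if v: "v \<in> ?X b" for v
  proof
    fix y
    have "Phi_comb n a b c v y = (\<Sum>t\<le>b. c t * Phi_map n a b t v y)"
      by (simp add: Phi_comb_def atLeast0AtMost)
    also have "\<dots> = (\<Sum>t\<le>b. fscale (c t / (fact t * fact t)) ((ext_F ^^ t) ((ext_E ^^ t) v)) y)"
      by (rule sum.cong) (auto simp: Phi_map[OF v])
    finally show "Phi_comb n a b c v y = Phi c b v y" by (simp add: Phi_def sum_fun_apply)
  qed
  then have image: "Phi_image n a b c = Phi c b ` ?X b"
    unfolding Phi_image_def tens0 by (rule image_cong[OF refl])
  have schur: "schur_rel n (a + i) (b - i) = rel (b - i)"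
  proof (cases "b - i")
    case 0
    then show ?thesis by (simp add: schur_rel_def rel_def zero_fun_def)
  next
    case (Suc q)
    have "a + i + 1 + q = a + b" using Suc assms(3) by simp
    then have t: "tens_space n (a + i + 1) q = ?X q" by (simp only: tens_space_eq_wspace)
    have "theta_map n (a + i + 1) q 1 v = ext_F v" if "v \<in> ?X q" for v
      using theta_map_eq[of v n "a + i + 1" q 1] that t by simp
    then show ?thesis unfolding schur_rel_def rel_def Suc using t by (auto intro!: image_cong)
  qed
  have equivariant: "equivariant (ext_act n g)" if "g \<in> GL n" for g :: "'k mat"
    using that unfolding equivariant_def GL_def
    by (auto simp: linear_ext_act ext_act_wspace ext_act_ext_E ext_act_ext_F)
  have act: "tens_act n a b g v = ext_act n g v" if "v \<in> ?X b" for g v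
    using that tens0 by (intro tens_act_eq_ext_act) simp
  have act': "tens_act n (a + i) (b - i) g v = ext_act n g v" if "v \<in> ?X (b - i)" for g v
    using that tens[OF assms(3)] by (intro tens_act_eq_ext_act) simp
  have WX: "Phi c b ` ?X b \<subseteq> ?X b"
  proof safe
    fix v assume v: "v \<in> ?X b"
    show "Phi c b v \<in> ?X b"
      unfolding Phi_def
    proof (intro fun_space.subspace_sum fun_space.subspace_scale subspace_X)
      fix t assume "t \<in> {..b}"
      then have "(ext_F ^^ t) ((ext_E ^^ t) v) \<in> ?X (b - t + t)"
        using v by (intro Fpow_X Epow_X) simp
      then show "(ext_F ^^ t) ((ext_E ^^ t) v) \<in> ?X b" using \<open>t \<in> {..b}\<close> by simp
    qed
  qed
  have subW: "fun_space.subspace (Phi c b ` ?X b)" by (rule Phi.subspace_image[OF subspace_X])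
  show ?thesis
    unfolding image schur tens0 tens[OF assms(3)]
  proof
    assume iso: "quot_iso (GL n) (tens_act n a b) (?X b) (Phi c b ` ?X b)
      (tens_act n (a + i) (b - i)) (?X (b - i)) (rel (b - i))"
    obtain \<rho> where \<rho>: "\<And>v. v \<in> ?X b \<Longrightarrow> \<exists>v'\<in>?X (b - i). \<rho> v v'" "\<And>v'. v' \<in> ?X (b - i) \<Longrightarrow> \<exists>v\<in>?X b. \<rho> v v'"
      "\<And>a u v u' v'. u \<in> ?X b \<Longrightarrow> v \<in> ?X b \<Longrightarrow> u' \<in> ?X (b - i) \<Longrightarrow> v' \<in> ?X (b - i) \<Longrightarrow> \<rho> u u' \<Longrightarrow> \<rho> v v' \<Longrightarrow>
         \<rho> (fscale a u + v) (fscale a u' + v')"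
      "\<And>v v'. v \<in> ?X b \<Longrightarrow> v' \<in> ?X (b - i) \<Longrightarrow> \<rho> v v' \<Longrightarrow> v \<in> Phi c b ` ?X b \<longleftrightarrow> v' \<in> rel (b - i)"
      "\<And>w w'. w \<in> Phi c b ` ?X b \<Longrightarrow> w' \<in> rel (b - i) \<Longrightarrow> \<rho> w w'"
      "\<And>g v v'. g \<in> GL n \<Longrightarrow> v \<in> ?X b \<Longrightarrow> v' \<in> ?X (b - i) \<Longrightarrow> \<rho> v v' \<Longrightarrow>
         \<rho> (tens_act n a b g v) (tens_act n (a + i) (b - i) g v')"
      by (rule quot_isoE[OF iso subspace_X subspace_X subW subspace_rel WX rel_X]) (rule that)
    \<comment> \<open>On the basis tensor of \<open>(S,T)\<close> this matrix has the eigenvalue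
      \<open>2\<close> to the sum of all indices in \<open>S\<close> and \<open>T\<close>. This sum
      separates the weights of the vectors \<open>hw a b j\<close>, with eigenvalues
      \<open>\<omega> j\<close>.\<close>
    define g where "g = diagonal n (\<lambda>i. 2 ^ i :: 'k)"
    have g: "g \<in> GL n" unfolding g_def by (rule diagonal_GL) simp
    have g_apply: "ext_act n g v (S,T) = 2 ^ (\<Sum>S + \<Sum>T) * v (S,T)" if "v \<in> ?X q" for q v S T
      unfolding g_def ext_act_diagonal[OF that] by (simp add: power_add power_sum)
    define \<omega> where "\<omega> j = (2 ^ (\<Sum>{..<a + j} + \<Sum>{..<b - j}) :: 'k)" for j
    obtain T where T: "finite T" "?X (b - i) \<subseteq> fun_space.span T" using wspace_subset_span by blast
    have "eig c b i = 0 \<and> (\<forall>j\<le>b. j \<noteq> i \<longrightarrow> eig c b j \<noteq> 0)"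
    proof (rule coker_iso_imp_eig[where e = "hw a b" and \<omega> = \<omega> and g = "ext_act n g" and \<rho> = \<rho>, OF b assms(3) equivariant[OF g]])
      fix j assume j: "j \<le> b"
      show "hw a b j \<in> H (b - j)"
        using hw_wspace[OF j assms(2)] ext_E_hw[OF assms(1) j assms(2)] by (simp add: H_def)
      show "hw a b j \<noteq> (0 :: 'k pvec)"
      proof
        assume "hw a b j = (0 :: 'k pvec)"
        then have "hw a b j ({..<a + j}, {..<b - j}) = (0 :: 'k)" by (metis zero_fun_apply)
        then show False by (simp add: hw_def)
      qed
      show "ext_act n g (hw a b j) = fscale (\<omega> j) (hw a b j)"
      proof (rule ext, clarify)
        fix S T
        show "ext_act n g (hw a b j) (S,T) = fscale (\<omega> j) (hw a b j) (S,T)"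
          unfolding g_apply[OF hw_wspace[OF j assms(2)]] by (simp add: hw_def \<omega>_def)
      qed
      fix k v assume k: "k \<le> b" and v: "v \<in> ?X (b - k)" "ext_act n g v = fscale (\<omega> j) v" "v \<noteq> 0"
      obtain S T where ST: "v (S,T) \<noteq> 0" using v(3) by (auto simp: fun_eq_iff)
      have "2 ^ (\<Sum>S + \<Sum>T) * v (S,T) = \<omega> j * v (S,T)"
        using g_apply[OF v(1), of S T] unfolding v(2) by auto
      then have eq: "\<Sum>S + \<Sum>T = \<Sum>{..<a + j} + \<Sum>{..<b - j}"
        using ST two_power_eq_iff[where 'k = 'k] unfolding \<omega>_def by (metis mult_right_cancel)
      note D = wspaceD[OF v(1) ST]
      have "finite S" "finite T" using D finite_subset by auto
      moreover have "card S = a + k" "card T = b - k" using D k by auto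
      \<comment> \<open>The pair of initial segments has the least index sum in its degrees, and
        that minimum grows strictly with \<open>k\<close>; this is the dominance hypothesis.\<close>
      ultimately have "\<Sum>{..<a + k} + \<Sum>{..<b - k} \<le> \<Sum>S + \<Sum>T"
        using sum_lessThan_card_le by (metis add_mono)
      then show "k \<le> j" using dominance_sum_less[OF assms(1) _ k, of j] eq by (metis leD leI)
    next
      show "finite T" "?X (b - i) \<subseteq> fun_space.span T" by (rule T)+
      show "\<rho> (ext_act n g v) (ext_act n g v')" if "v \<in> ?X b" "v' \<in> ?X (b - i)" "\<rho> v v'" for v v'
        using \<rho>(6)[OF g that] that by (simp add: act act')
    qed (fact \<rho>)+
    then show "(\<Sum>t\<in>{0..i}. c t * ccoef a b i t) = 0 \<and>
        (\<forall>j\<in>{0..b} - {i}. (\<Sum>t\<in>{0..j}. c t * ccoef a b j t) \<noteq> 0)"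
      unfolding eig by auto
  next
    assume "(\<Sum>t\<in>{0..i}. c t * ccoef a b i t) = 0 \<and>
        (\<forall>j\<in>{0..b} - {i}. (\<Sum>t\<in>{0..j}. c t * ccoef a b j t) \<noteq> 0)"
    then have e: "eig c b i = 0" "\<And>j. j \<le> b \<Longrightarrow> j \<noteq> i \<Longrightarrow> eig c b j \<noteq> 0" unfolding eig by auto
    obtain \<phi> where \<phi>: "\<And>v. v \<in> ?X b \<Longrightarrow> \<phi> v \<in> ?X (b - i)"
      "\<And>a u v. u \<in> ?X b \<Longrightarrow> v \<in> ?X b \<Longrightarrow> \<phi> (fscale a u + v) = fscale a (\<phi> u) + \<phi> v"
      "\<And>v. v \<in> ?X b \<Longrightarrow> \<phi> v \<in> rel (b - i) \<longleftrightarrow> v \<in> Phi c b ` ?X b"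
      "\<And>w. w \<in> ?X (b - i) \<Longrightarrow> \<exists>v\<in>?X b. \<phi> v - w \<in> rel (b - i)"
      "\<And>g v. equivariant g \<Longrightarrow> v \<in> ?X b \<Longrightarrow> \<phi> (g v) = g (\<phi> v)"
      by (rule coker_map[OF b assms(3) e(1)]; (rule e(2) | rule that))
    show "quot_iso (GL n) (tens_act n a b) (?X b) (Phi c b ` ?X b)
      (tens_act n (a + i) (b - i)) (?X (b - i)) (rel (b - i))"
    proof (rule quot_isoI[where \<phi> = \<phi>, OF subspace_X subspace_X subW subspace_rel \<phi>(1-4)])
      fix g :: "'k mat" assume g: "g \<in> GL n"
      interpret ga: Vector_Spaces.linear fscale fscale "ext_act n g" by (rule linear_ext_act)
      note gX = ext_act_wspace[of _ n "a + b" _ g]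
      show "tens_act n a b g v \<in> ?X b" if "v \<in> ?X b" for v using that by (simp add: act gX)
      show "\<phi> (tens_act n a b g v) = tens_act n (a + i) (b - i) g (\<phi> v)" if "v \<in> ?X b" for v
        using \<phi>(5)[OF equivariant[OF g] that] that by (simp add: act act' \<phi>(1))
      show "tens_act n (a + i) (b - i) g (u - v) =
          tens_act n (a + i) (b - i) g u - tens_act n (a + i) (b - i) g v"
        if "u \<in> ?X (b - i)" "v \<in> ?X (b - i)" for u v
        using that fun_space.subspace_diff[OF subspace_X that] by (simp add: act' ga.diff)
      \<comment> \<open>The relations are stable under the group because they form the image of
        \<open>ext_F\<close>, which commutes with it, or are zero.\<close>
      show "tens_act n (a + i) (b - i) g w \<in> rel (b - i)" if w: "w \<in> rel (b - i)" for w
      proof -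
        have "ext_act n g w \<in> rel (b - i)"
        proof (cases "b - i = 0")
          case False
          then obtain x where "x \<in> ?X (b - i - 1)" "w = ext_F x" using w by (auto simp: rel_def)
          then show ?thesis
            using False gX equivariant[OF g] unfolding rel_def equivariant_def by auto
        qed (use w in \<open>simp add: rel_def ga.zero\<close>)
        moreover have "w \<in> ?X (b - i)" using w rel_X by blast
        ultimately show ?thesis by (simp add: act')
      qed
    qed
  qed
qed

end
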